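(* Let $N\ge 3$ and $s\in(0,1)$. Let $u\in C^\infty(\mathbb S^N)$, $v:=u\circ\sigma^{-1}:\mathbb R^N\to\mathbb R$, $z\in\mathbb S^N\setminus\{-e_{N+1}\}$ and $x=\sigma(z)\in\mathbb R^N$. Then $$\mathscr P^s_g u(z)=\psi_s(x)^{-\frac{N+2s}{N-2s}}\,(-\Delta)^s(\psi_s v)(x),\qquad \psi_s(x):=\left(\frac{2}{1+|x|^2}\right)^{\frac{N-2s}{2}} .$$
   Context: $\mathbb S^N\subset\mathbb R^{N+1}$ is the unit sphere with its round metric $g$ and volume element $dV_g$; $e_{N+1}$ is the north pole. The stereographic projection $\sigma:\mathbb S^N\setminus\{-e_{N+1}\}\to\mathbb R^N$ is $\sigma(z',z_{N+1})=\frac{z'}{1+z_{N+1}}$. The conformal fractional Laplacian is defined for $u\in C^\infty(\mathbb S^N)$ by $$\mathscr P^s_g u(z):=c_{N,s}\,\mathrm{p.v.}\int_{\mathbb S^N}\frac{u(z)-u(\zeta)}{|z-\zeta|^{N+2s}}\,dV_g(\zeta)+A_{N,s}u(z),$$ where $|\cdot|$ is the Euclidean norm of $\mathbb R^{N+1}$, $c_{N,s}:=4^s\pi^{-N/2}\frac{\Gamma(\frac N2+s)}{\Gamma(2-s)}s(1-s)$ and $A_{N,s}:=\frac{\Gamma(\frac N2+s)}{\Gamma(\frac N2-s)}$. The fractional Laplacian on $\mathbb R^N$ is $(-\Delta)^s w(x)=c_{N,s}\,\mathrm{p.v.}\int_{\mathbb R^N}\frac{w(x)-w(y)}{|x-y|^{N+2s}}\,dy$.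 *)

theory Defs
  imports "HOL-Analysis.Analysis"
begin

text \<open>
  The dimension is $N = $ \<open>CARD('n)\<close>, and $\mathbb R^{N+1}$ is \<open>(real^'n) \<times> real\<close>, whose norm and inner
  product are the Euclidean ones; a point is written $(z', z_{N+1})$.
\<close>

abbreviation unit_sphere :: "((real^'n) \<times> real) set" where
  "unit_sphere \<equiv> sphere 0 1"

definition north :: "(real^'n) \<times> real" where
  "north = (0, 1)"

definition stereo :: "(real^'n) \<times> real \<Rightarrow> real^'n" where
  "stereo z = fst z /\<^sub>R (1 + snd z)"

definition stereo_inv :: "real^'n \<Rightarrow> (real^'n) \<times> real" where
  "stereo_inv = inv_into (unit_sphere - {- north}) stereo"

subsection \<open>Smooth functions on the sphere\<close>

fun Ck_on :: "nat \<Rightarrow> 'a::euclidean_space set \<Rightarrow> ('a \<Rightarrow> real) \<Rightarrow> bool" where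
  "Ck_on 0 U f \<longleftrightarrow> continuous_on U f"
| "Ck_on (Suc k) U f \<longleftrightarrow>
     (\<forall>x\<in>U. f differentiable (at x)) \<and> (\<forall>v. Ck_on k U (\<lambda>x. frechet_derivative f (at x) v))"

text \<open>
  Smoothness on a subset of Euclidean space, for the sphere the same as smoothness on the
  embedded submanifold: near each point of \<open>S\<close> the function extends to a smooth function on an
  open set. The values of \<open>u\<close> outside \<open>S\<close> are irrelevant.
\<close>

definition smooth_fun_on :: "'a::euclidean_space set \<Rightarrow> ('a \<Rightarrow> real) \<Rightarrow> bool" where
  "smooth_fun_on S u \<longleftrightarrow>
     (\<forall>z\<in>S. \<exists>U F. open U \<and> z \<in> U \<and> (\<forall>k. Ck_on k U F) \<and> (\<forall>y\<in>U \<inter> S. F y = u y))"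

subsection \<open>The volume element of the round metric\<close>

text \<open>
  For a parametrization \<open>\<phi>\<close> of a hypersurface, the matrix
  $g_{ij} = \langle \partial_i \phi, \partial_j \phi\rangle$ of the induced metric.
\<close>

definition induced_metric :: "(real^'n \<Rightarrow> (real^'n) \<times> real) \<Rightarrow> real^'n \<Rightarrow> real^'n^'n" where
  "induced_metric \<phi> x =
     (\<chi> i j. frechet_derivative \<phi> (at x) (axis i 1) \<bullet> frechet_derivative \<phi> (at x) (axis j 1))"

text \<open>
  $dV_g = \sqrt{\det g}\,dx$ in the coordinates $\sigma$. This measure does not depend on the choice
  of chart, and the only point outside the domain of $\sigma$, the south pole, has measure zero.
\<close>

definition sphere_volume :: "((real^'n) \<times> real) measure" where
  "sphere_volume =
     distr (density lborel (\<lambda>x. ennreal (sqrt (det (induced_metric stereo_inv x)))))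
       (restrict_space borel unit_sphere) stereo_inv"

subsection \<open>Principal values\<close>

definition has_pv_integral :: "'a::metric_space measure \<Rightarrow> ('a \<Rightarrow> real) \<Rightarrow> 'a \<Rightarrow> real \<Rightarrow> bool" where
  "has_pv_integral M f z I \<longleftrightarrow>
     (\<forall>\<epsilon>>0. set_integrable M {y \<in> space M. \<epsilon> \<le> dist z y} f) \<and>
     ((\<lambda>\<epsilon>. LINT y:{y \<in> space M. \<epsilon> \<le> dist z y}|M. f y) \<longlongrightarrow> I) (at_right 0)"

definition pv_integral :: "'a::metric_space measure \<Rightarrow> ('a \<Rightarrow> real) \<Rightarrow> 'a \<Rightarrow> real" where
  "pv_integral M f z = (THE I. has_pv_integral M f z I)"

subsection \<open>The fractional operators\<close>

definition c_const :: "nat \<Rightarrow> real \<Rightarrow> real" where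
  "c_const N s = 4 powr s * pi powr (- (real N / 2)) *
     (Gamma (real N / 2 + s) / Gamma (2 - s)) * s * (1 - s)"

definition A_const :: "nat \<Rightarrow> real \<Rightarrow> real" where
  "A_const N s = Gamma (real N / 2 + s) / Gamma (real N / 2 - s)"

text \<open>
  The integrand of both operators at the point \<open>z\<close>. The number \<open>N\<close> is passed explicitly because on
  the sphere it is not the dimension of the ambient space.
\<close>

definition frac_integrand ::
    "nat \<Rightarrow> real \<Rightarrow> ('a::real_normed_vector \<Rightarrow> real) \<Rightarrow> 'a \<Rightarrow> 'a \<Rightarrow> real" where
  "frac_integrand N s w z y = (w z - w y) / norm (z - y) powr (real N + 2 * s)"

definition conf_frac_laplacian ::
    "real \<Rightarrow> ((real^'n) \<times> real \<Rightarrow> real) \<Rightarrow> (real^'n) \<times> real \<Rightarrow> real" where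
  "conf_frac_laplacian s u z =
     c_const CARD('n) s * pv_integral sphere_volume (frac_integrand CARD('n) s u z) z +
     A_const CARD('n) s * u z"

definition frac_laplacian :: "real \<Rightarrow> (real^'n \<Rightarrow> real) \<Rightarrow> real^'n \<Rightarrow> real" where
  "frac_laplacian s w x =
     c_const CARD('n) s * pv_integral lborel (frac_integrand CARD('n) s w x) x"

definition psi :: "real \<Rightarrow> real^'n \<Rightarrow> real" where
  "psi s x = (2 / (1 + (norm x)\<^sup>2)) powr ((real CARD('n) - 2 * s) / 2)"

end

theory Submission
  imports Defs "HOL-Probability.Distributions" "HOL-Real_Asymp.Real_Asymp"
begin

text \<open>
  Write \<open>N = CARD('n)\<close>, \<open>p = N - 2 s\<close>, \<open>z = stereo_inv x\<close> and \<open>a = 1 + |x|^2\<close>. Both integrals are moved to the same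
  chart, in which the pole is at infinity: the inversion \<open>y = x + a m / |m|^2\<close> followed by the
  shift \<open>n = x + m\<close>. The point \<open>\<zeta> n\<close> of the sphere with stereographic coordinate \<open>y\<close> is the image
  of \<open>n\<close> under the stereographic parametrization based at the antipode of \<open>z\<close>, so
  \<open>|z - \<zeta> n| = 2 / sqrt (1 + |n|^2)\<close>
  (lemmas \<open>stereo_inv_inversion\<close> and \<open>norm_antipodal_param_diff\<close>). With \<open>b n = (1 + |n|^2) powr (- p / 2)\<close>
  and \<open>W n = (u z - u (\<zeta> n)) * b n\<close>, the truncated integrals become integrals over balls:
  the one on the sphere is \<open>4 powr (- s)\<close> times the integral of \<open>W\<close> over \<open>|n| \<le> R\<close>, and the one on the flat
  space is \<open>a powr (- 2 s) * (2 / a) powr (p / 2)\<close> times the integral over \<open>|n - x| \<le> R\<close> of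
  \<open>W n + u z * (|n - x| powr (- p) - b n)\<close>.
  Principal values are thereby limits for \<open>R\<close> tending to infinity, and three facts suffice.

  The integral of \<open>W\<close> over centred balls converges. Indeed \<open>\<zeta> n + \<zeta> (- n) - 2 z\<close> is of order
  \<open>1 / (1 + |n|^2)\<close>, so a second order Taylor bound for \<open>u\<close> at \<open>z\<close> makes the even part of \<open>W\<close>
  integrable (\<open>chart_integrand_estimates\<close>).

  Shifting the ball by \<open>x\<close> changes the integrals of \<open>W\<close> and of \<open>b\<close> by amounts that tend to 0. The two balls have equal
  volume and differ within a shell of volume \<open>O(R ^ (N - 1))\<close>, on which the function differs from a constant
  by \<open>O(R powr (- p - 1))\<close>, and \<open>N - 1 - p - 1 = 2 s - 2 < 0\<close> (\<open>shifted_ball_integral_limit\<close>).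

  The remaining integral of \<open>|m| powr (- p) - b m\<close> is absolutely convergent and does not depend on \<open>x\<close>.
  Writing both powers as superpositions of Gaussians, Tonelli's theorem gives
  \<open>pi powr (N / 2) * Gamma (1 - s) / (s * Gamma (N / 2 - s))\<close>
  (\<open>has_bochner_integral_powr_minus_bracket\<close>). This number, multiplied by \<open>4 powr (- s) * c_const N s\<close>, is
  \<open>A_const N s\<close>; it is the source of the zeroth order term of the operator on the sphere.
\<close>

section \<open>Inversion as a change of variables\<close>

text \<open>
  The change of variables theorem for \<open>real ^ 'n\<close> asks for a wellordered index type. A copy of a
  finite type is therefore ordered by an arbitrary injection into the natural numbers, and the
  formula is carried back along the relabelling of coordinates.
\<close>

typedef 'a ranked = "UNIV :: 'a set" by simp

instance ranked :: (finite) finite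
proof
  have "(UNIV :: 'a ranked set) = Abs_ranked ` UNIV"
    by (metis Abs_ranked_cases UNIV_eq_I rangeI)
  then show "finite (UNIV :: 'a ranked set)"
    by (metis finite finite_imageI)
qed

text \<open>
  An arbitrary numbering of the finite type; only its injectivity matters.
\<close>

definition rank :: "'a::finite ranked \<Rightarrow> nat" where
  "rank = (SOME f. inj f)"

lemma inj_rank: "inj rank"
proof -
  have "\<exists>f :: 'a ranked \<Rightarrow> nat. inj f"
    using finite_imp_inj_to_nat_seg[OF finite[of "UNIV :: 'a ranked set"]] by auto
  then show ?thesis unfolding rank_def by (rule someI_ex)
qed

instantiation ranked :: (finite) wellorder
begin

definition less_eq_ranked :: "'a ranked \<Rightarrow> 'a ranked \<Rightarrow> bool" where
  "less_eq_ranked i j \<longleftrightarrow> rank i \<le> rank j"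

definition less_ranked :: "'a ranked \<Rightarrow> 'a ranked \<Rightarrow> bool" where
  "less_ranked i j \<longleftrightarrow> rank i < rank j"

instance
proof
  fix P :: "'a ranked \<Rightarrow> bool" and i
  assume step: "\<And>i. (\<And>j. j < i \<Longrightarrow> P j) \<Longrightarrow> P i"
  show "P i"
    by (induction i rule: measure_induct_rule[of rank]) (auto intro: step simp: less_ranked_def)
qed (use inj_rank in \<open>auto simp: less_eq_ranked_def less_ranked_def inj_def intro: linear\<close>)

end

lemma bij_Abs_ranked: "bij Abs_ranked"
  by (rule o_bij[of Rep_ranked]) (auto simp: Abs_ranked_inverse Rep_ranked_inverse)

text \<open>
  The relabelling of coordinates and its inverse, both linear isometries.
\<close>

definition reindex :: "real^'n \<Rightarrow> real^('n::finite ranked)" where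
  "reindex x = (\<chi> i. x $ Rep_ranked i)"

definition unindex :: "real^('n::finite ranked) \<Rightarrow> real^'n" where
  "unindex x = (\<chi> i. x $ Abs_ranked i)"

lemma reindex_unindex [simp]: "reindex (unindex x) = x" "unindex (reindex y) = y"
  by (auto simp: reindex_def unindex_def vec_eq_iff Rep_ranked_inverse Abs_ranked_inverse)

lemma linear_unindex: "linear unindex"
  by (auto simp: unindex_def vec_eq_iff intro!: linearI)

lemma inner_unindex: "unindex x \<bullet> unindex y = x \<bullet> y"
  unfolding inner_vec_def unindex_def vec_lambda_beta
  by (rule sum.reindex_bij_betw[OF bij_Abs_ranked])

lemma norm_unindex [simp]: "norm (unindex x) = norm x"
  by (simp add: norm_eq_sqrt_inner inner_unindex)

lemma measurable_unindex [measurable]: "unindex \<in> borel_measurable borel"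
  by (intro borel_measurable_continuous_onI linear_continuous_on
      linear_conv_bounded_linear[THEN iffD1] linear_unindex)

lemma CARD_ranked: "CARD('n::finite ranked) = CARD('n)"
  by (rule bij_betw_same_card[OF bij_Abs_ranked, symmetric])

lemma prod_Basis_cart: "(\<Prod>b\<in>Basis. (x :: real^'n) \<bullet> b) = (\<Prod>i\<in>UNIV. x $ i)"
proof -
  have "bij_betw (\<lambda>i. axis i 1 :: real^'n) UNIV Basis"
    by (auto simp: bij_betw_def inj_on_def axis_eq_axis Basis_vec_def)
  from prod.reindex_bij_betw[OF this, of "\<lambda>b. x \<bullet> b"] show ?thesis
    by (simp add: inner_axis)
qed

lemma distr_unindex: "distr lborel borel unindex = (lborel :: (real^'n::finite) measure)"
proof (rule lborel_eqI[symmetric])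
  fix l u :: "real^'n"
  assume le: "\<And>b. b \<in> Basis \<Longrightarrow> l \<bullet> b \<le> u \<bullet> b"
  have le': "l $ i \<le> u $ i" for i
    using le[of "axis i 1"] by (auto simp: inner_axis axis_in_Basis_iff)
  have *: "unindex -` box l u = box (reindex l) (reindex u)"
    by (auto simp: mem_box_cart reindex_def unindex_def)
      (metis Rep_ranked_inverse, metis Rep_ranked_inverse, metis Abs_ranked_inverse UNIV_I, metis Abs_ranked_inverse UNIV_I)
  have "emeasure lborel (box (reindex l) (reindex u)) = (\<Prod>b\<in>Basis. (reindex u - reindex l) \<bullet> b)"
    by (subst emeasure_lborel_box) (auto simp: Basis_vec_def inner_axis reindex_def le')
  also have "(\<Prod>b\<in>Basis. (reindex u - reindex l) \<bullet> b) = (\<Prod>i\<in>UNIV. (reindex u - reindex l) $ i)"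
    by (rule prod_Basis_cart)
  also have "\<dots> = (\<Prod>i\<in>UNIV. (u - l) $ i)"
    by (subst prod.reindex_bij_betw[OF bij_Abs_ranked, symmetric])
      (simp add: reindex_def Abs_ranked_inverse)
  also have "\<dots> = (\<Prod>b\<in>Basis. (u - l) \<bullet> b)"
    by (rule prod_Basis_cart[symmetric])
  finally show "emeasure (distr lborel borel unindex) (box l u) = ennreal (\<Prod>b\<in>Basis. (u - l) \<bullet> b)"
    by (simp add: emeasure_distr *)
qed simp

text \<open>
  Inversion in the sphere of radius \<open>sqrt a\<close> about the origin, for \<open>a > 0\<close>; the value at the
  origin is 0.
\<close>

definition inversion :: "real \<Rightarrow> 'a::real_normed_vector \<Rightarrow> 'a" where
  "inversion a m = (a / (norm m)\<^sup>2) *\<^sub>R m"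

lemma inversion_inversion: "a \<noteq> 0 \<Longrightarrow> inversion a (inversion a m) = m"
  by (cases "m = 0") (auto simp: inversion_def power2_eq_square)

lemma has_derivative_inversion:
  fixes m :: "'a::real_inner"
  assumes "m \<noteq> 0"
  shows "(inversion a has_derivative
    (\<lambda>h. (a / (norm m)\<^sup>2) *\<^sub>R h - (2 * a * (m \<bullet> h) / (norm m)^4) *\<^sub>R m)) (at m within S)"
proof -
  have "((\<lambda>m. (a / (m \<bullet> m)) *\<^sub>R m) has_derivative
      (\<lambda>h. (a / (m \<bullet> m)) *\<^sub>R h + (- (a * (2 * (m \<bullet> h)) / (m \<bullet> m)^2)) *\<^sub>R m)) (at m within S)"
    using assms
    by (auto intro!: derivative_eq_intros simp: inner_commute field_simps power2_eq_square)
  then show ?thesis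
    unfolding inversion_def
    by (simp add: dot_square_norm power_mult[symmetric] mult_ac)
qed

text \<open>
  A linear map that scales all inner products by \<open>c^2\<close> scales volumes by \<open>|c|^N\<close>.
\<close>

lemma abs_det_conformal:
  fixes D :: "real^'n \<Rightarrow> real^'n"
  assumes "linear D" and "\<And>h k. D h \<bullet> D k = c\<^sup>2 * (h \<bullet> k)"
  shows "\<bar>det (matrix D)\<bar> = \<bar>c\<bar> ^ CARD('n)"
proof -
  have "transpose (matrix D) ** matrix D = mat (c\<^sup>2)"
  proof -
    have "(transpose (matrix D) ** matrix D) $ i $ j = mat (c\<^sup>2) $ i $ j" for i j
    proof -
      have "(transpose (matrix D) ** matrix D) $ i $ j = D (axis i 1) \<bullet> D (axis j 1)"
        by (simp add: matrix_matrix_mult_def transpose_def matrix_def inner_vec_def)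
      then show ?thesis
        by (simp add: assms(2) mat_def inner_axis_axis)
    qed
    then show ?thesis by (simp add: vec_eq_iff)
  qed
  then have "det (matrix D) ^ 2 = det (mat (c\<^sup>2) :: real^'n^'n)"
    by (metis det_mul det_transpose power2_eq_square)
  also have "\<dots> = (\<bar>c\<bar>\<^sup>2) ^ CARD('n)"
    by (subst det_diagonal) (auto simp: mat_def)
  also have "\<dots> = (\<bar>c\<bar> ^ CARD('n))\<^sup>2"
    by (simp only: power_mult[symmetric] mult.commute)
  finally have "\<bar>det (matrix D)\<bar>\<^sup>2 = (\<bar>c\<bar> ^ CARD('n))\<^sup>2" by simp
  then show ?thesis by (simp only: power2_eq_iff_nonneg abs_ge_zero zero_le_power)
qed

text \<open>
  The derivative of the inversion at \<open>m\<close> is conformal with factor \<open>a / |m|^2\<close>, being a multiple of a reflection.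
\<close>

lemma inner_derivative_inversion:
  fixes m h k :: "'a::real_inner"
  assumes "m \<noteq> 0"
  shows "((a / (norm m)\<^sup>2) *\<^sub>R h - (2 * a * (m \<bullet> h) / (norm m)^4) *\<^sub>R m) \<bullet>
    ((a / (norm m)\<^sup>2) *\<^sub>R k - (2 * a * (m \<bullet> k) / (norm m)^4) *\<^sub>R m) =
    (a / (norm m)\<^sup>2)\<^sup>2 * (h \<bullet> k)"
proof -
  define r where "r = norm m"
  have r: "r \<noteq> 0" "m \<bullet> m = r^2" using assms by (auto simp: r_def dot_square_norm)
  show ?thesis
    unfolding r_def[symmetric] using r
    by (simp add: inner_diff_left inner_diff_right inner_commute[of h m])
       (simp add: field_simps power2_eq_square power4_eq_xxxx)
qed

lemma inversion_lborel_wellorder: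
  fixes f :: "real^'m::{finite,wellorder} \<Rightarrow> real"
  assumes [measurable]: "f \<in> borel_measurable borel" and "a \<noteq> 0"
  shows "has_bochner_integral lborel f I \<longleftrightarrow>
    has_bochner_integral lborel (\<lambda>m. (\<bar>a\<bar> / (norm m)\<^sup>2) ^ CARD('m) * f (inversion a m)) I"
proof -
  define S :: "(real^'m::_) set" where "S = UNIV - {0}"
  define D where "D m h = (a / (norm m)\<^sup>2) *\<^sub>R h - (2 * a * (m \<bullet> h) / (norm m)^4) *\<^sub>R m" for m h :: "real^'m::_"
  define g where "g m = (\<bar>a\<bar> / (norm m)\<^sup>2) ^ CARD('m) * f (inversion a m)" for m
  have [measurable]: "inversion a \<in> borel_measurable (borel :: (real^'m::_) measure)"
    unfolding inversion_def by measurable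
  have gm[measurable]: "g \<in> borel_measurable borel"
    unfolding g_def by measurable
  have S: "S \<in> sets lebesgue" by (simp add: S_def)
  have der: "(inversion a has_derivative D m) (at m within S)" if "m \<in> S" for m
    using has_derivative_inversion[of m a S] that by (simp add: S_def D_def[abs_def])
  have det: "\<bar>det (matrix (D m))\<bar> = (\<bar>a\<bar> / (norm m)\<^sup>2) ^ CARD('m)" if "m \<in> S" for m
  proof -
    have "linear (D m)" using der[OF that] by (rule has_derivative_linear)
    then have "\<bar>det (matrix (D m))\<bar> = \<bar>a / (norm m)\<^sup>2\<bar> ^ CARD('m)"
      by (rule abs_det_conformal) (use that in \<open>simp add: D_def inner_derivative_inversion S_def\<close>)
    then show ?thesis by (simp add: abs_divide)
  qed
  have inj: "inj_on (inversion a) S"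
    by (rule inj_on_inverseI[of _ "inversion a"]) (simp add: inversion_inversion assms)
  have img: "inversion a ` S = S"
  proof -
    have "inversion a m \<in> S" if "m \<in> S" for m
      using that assms by (auto simp: inversion_def S_def)
    then show ?thesis
      by (force simp: image_iff intro: inversion_inversion[OF assms(2), symmetric])
  qed
  have "(\<lambda>x. \<bar>det (matrix (D x))\<bar> *\<^sub>R vec (f (inversion a x)) :: real^1) absolutely_integrable_on S \<and>
      integral S (\<lambda>x. \<bar>det (matrix (D x))\<bar> *\<^sub>R vec (f (inversion a x))) = (vec I :: real^1) \<longleftrightarrow>
      (\<lambda>x. vec (f x) :: real^1) absolutely_integrable_on (inversion a ` S) \<and>
      integral (inversion a ` S) (\<lambda>x. vec (f x)) = (vec I :: real^1)"
    by (rule has_absolute_integral_change_of_variables[OF S der inj])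
  then have "(\<lambda>x. \<bar>det (matrix (D x))\<bar> * f (inversion a x)) absolutely_integrable_on S \<and>
      integral S (\<lambda>x. \<bar>det (matrix (D x))\<bar> * f (inversion a x)) = I \<longleftrightarrow>
      f absolutely_integrable_on S \<and> integral S f = I"
    by (simp add: absolutely_integrable_on_1_iff integral_on_1_eq img)
  also have "(\<lambda>x. \<bar>det (matrix (D x))\<bar> * f (inversion a x)) absolutely_integrable_on S \<longleftrightarrow> g absolutely_integrable_on S"
    by (rule set_integrable_cong) (auto simp: det g_def)
  also have "integral S (\<lambda>x. \<bar>det (matrix (D x))\<bar> * f (inversion a x)) = integral S g"
    by (rule Henstock_Kurzweil_Integration.integral_cong) (auto simp: det g_def)
  finally have *: "g absolutely_integrable_on S \<and> integral S g = I \<longleftrightarrow>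
      f absolutely_integrable_on S \<and> integral S f = I" .
  have conv: "h absolutely_integrable_on S \<and> integral S h = I \<longleftrightarrow> has_bochner_integral lborel h I"
    if [measurable]: "h \<in> borel_measurable borel" for h :: "real^'m::_ \<Rightarrow> real"
  proof -
    \<comment> \<open>The origin, where the inversion takes a default value, is a null set.\<close>
    have "AE x in lborel. x \<noteq> (0 :: real^'m::_)" by (rule AE_lborel_singleton)
    then have ae: "AE x in lborel. indicator S x *\<^sub>R h x = h x"
      by (eventually_elim) (auto simp: S_def)
    have Sb: "S \<in> sets borel" by (simp add: S_def)
    have "h absolutely_integrable_on S \<longleftrightarrow> integrable lborel (\<lambda>x. indicator S x *\<^sub>R h x)"
      unfolding set_integrable_def by (rule integrable_completion) (use Sb in measurable)
    also have "\<dots> \<longleftrightarrow> integrable lborel h"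
      by (rule integrable_cong_AE) (use Sb ae in auto)
    finally have i: "h absolutely_integrable_on S \<longleftrightarrow> integrable lborel h" .
    moreover have "integral S h = integral\<^sup>L lborel h" if "h absolutely_integrable_on S"
    proof -
      have "integral S h = (LINT x:S|lebesgue. h x)"
        using set_lebesgue_integral_eq_integral(2)[OF that] by simp
      also have "\<dots> = integral\<^sup>L lborel (\<lambda>x. indicator S x *\<^sub>R h x)"
        unfolding set_lebesgue_integral_def by (rule integral_completion) (use Sb in measurable)
      also have "\<dots> = integral\<^sup>L lborel h"
        by (rule integral_cong_AE) (use Sb ae in auto)
      finally show ?thesis .
    qed
    ultimately show ?thesis by (auto simp: has_bochner_integral_iff)
  qed
  show ?thesis using * conv[of f] conv[OF gm] unfolding g_def by simp
qed

lemma measurable_inversion [measurable]: "inversion a \<in> borel_measurable (borel :: 'a::euclidean_space measure)"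
  unfolding inversion_def by measurable

lemma has_bochner_integral_distr_eq:
  fixes f :: "'b \<Rightarrow> real"
  assumes "T \<in> measurable M N" "f \<in> borel_measurable N"
  shows "has_bochner_integral (distr M N T) f I \<longleftrightarrow> has_bochner_integral M (\<lambda>x. f (T x)) I"
  using assms by (simp add: has_bochner_integral_iff integrable_distr_eq integral_distr)

lemma inversion_unindex: "inversion a (unindex m) = unindex (inversion a m)"
  by (simp add: inversion_def linear_scale[OF linear_unindex])

lemma has_bochner_integral_inversion:
  fixes f :: "real^'n \<Rightarrow> real"
  assumes [measurable]: "f \<in> borel_measurable borel" and "a \<noteq> 0"
  shows "has_bochner_integral lborel f I \<longleftrightarrow>
    has_bochner_integral lborel (\<lambda>m. (\<bar>a\<bar> / (norm m)\<^sup>2) ^ CARD('n) * f (inversion a m)) I"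
proof -
  have "has_bochner_integral lborel f I \<longleftrightarrow> has_bochner_integral lborel (\<lambda>m. f (unindex m)) I"
    by (subst distr_unindex[symmetric], subst has_bochner_integral_distr_eq) auto
  also have "\<dots> \<longleftrightarrow> has_bochner_integral lborel
      (\<lambda>m. (\<bar>a\<bar> / (norm (unindex m))\<^sup>2) ^ CARD('n) * f (inversion a (unindex m))) I"
    by (subst inversion_lborel_wellorder[of _ a]) (auto simp: inversion_unindex assms CARD_ranked)
  also have "\<dots> \<longleftrightarrow> has_bochner_integral lborel
      (\<lambda>m. (\<bar>a\<bar> / (norm m)\<^sup>2) ^ CARD('n) * f (inversion a m)) I"
    by (subst (2) distr_unindex[symmetric], subst has_bochner_integral_distr_eq) auto
  finally show ?thesis .
qed

lemma has_bochner_integral_translate: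
  fixes f :: "'a::euclidean_space \<Rightarrow> real"
  assumes [measurable]: "f \<in> borel_measurable borel"
  shows "has_bochner_integral lborel f I \<longleftrightarrow> has_bochner_integral lborel (\<lambda>x. f (c + x)) I"
  by (subst (1) lborel_distr_plus[of c, symmetric], subst has_bochner_integral_distr_eq) auto

lemma has_bochner_integral_reflect:
  fixes f :: "'a::euclidean_space \<Rightarrow> real"
  assumes [measurable]: "f \<in> borel_measurable borel"
  shows "has_bochner_integral lborel f I \<longleftrightarrow> has_bochner_integral lborel (\<lambda>x. f (- x)) I"
proof -
  have "distr lborel borel uminus = (lborel :: 'a measure)"
    by (subst (2) lborel_affine[of "-1" 0]) (auto simp: density_1 one_ennreal_def[symmetric])
  then have "has_bochner_integral lborel f I \<longleftrightarrow> has_bochner_integral (distr lborel borel uminus) f I"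
    by simp
  also have "\<dots> \<longleftrightarrow> has_bochner_integral lborel (\<lambda>x. f (- x)) I"
    by (rule has_bochner_integral_distr_eq) auto
  finally show ?thesis .
qed

section \<open>Gaussian integrals and the constant of the bubble\<close>

lemma nn_integral_gaussian_real:
  assumes "t > 0"
  shows "(\<integral>\<^sup>+x. ennreal (exp (- t * x\<^sup>2)) \<partial>lborel) = ennreal (sqrt (pi / t))"
proof -
  define \<sigma> where "\<sigma> = 1 / sqrt (2 * t)"
  have \<sigma>: "\<sigma> > 0" "2 * \<sigma>\<^sup>2 = 1 / t"
    using assms by (auto simp: \<sigma>_def power_divide)
  have "exp (- t * x\<^sup>2) = sqrt (pi / t) * normal_density 0 \<sigma> x" for x
  proof -
    have "2 * pi * \<sigma>\<^sup>2 = pi / t" and e: "- (x\<^sup>2) / (2 * \<sigma>\<^sup>2) = - t * x\<^sup>2"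
      using \<sigma>(2) assms by (simp_all add: mult.assoc[symmetric] mult.commute[of 2 pi])
        (simp add: mult.assoc)
    then have "normal_density 0 \<sigma> x = 1 / sqrt (pi / t) * exp (- t * x\<^sup>2)"
      unfolding normal_density_def diff_0_right by (simp only: e)
    then show ?thesis using assms by simp
  qed
  then have "(\<integral>\<^sup>+x. ennreal (exp (- t * x\<^sup>2)) \<partial>lborel) =
      (\<integral>\<^sup>+x. ennreal (sqrt (pi / t)) * ennreal (normal_density 0 \<sigma> x) \<partial>lborel)"
    using assms by (simp add: ennreal_mult')
  also have "\<dots> = ennreal (sqrt (pi / t)) * (\<integral>\<^sup>+x. ennreal (normal_density 0 \<sigma> x) \<partial>lborel)"
    by (rule nn_integral_cmult) auto
  also have "(\<integral>\<^sup>+x. ennreal (normal_density 0 \<sigma> x) \<partial>lborel) = 1"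
    using \<sigma>(1) by (subst nn_integral_eq_integral) auto
  finally show ?thesis by simp
qed

lemma nn_integral_gaussian:
  assumes "t > 0"
  shows "(\<integral>\<^sup>+(x::'a::euclidean_space). ennreal (exp (- t * (norm x)\<^sup>2)) \<partial>lborel)
    = ennreal ((pi / t) powr (DIM('a) / 2))"
proof -
  have "exp (- t * (norm x)\<^sup>2) = (\<Prod>b\<in>Basis. exp (- t * (x \<bullet> b)\<^sup>2))" for x :: 'a
  proof -
    have "(norm x)\<^sup>2 = (\<Sum>b\<in>Basis. (x \<bullet> b)\<^sup>2)"
      by (subst power2_norm_eq_inner, subst euclidean_inner) (simp add: power2_eq_square)
    then show ?thesis by (simp add: exp_sum[symmetric] sum_distrib_left sum_negf)
  qed
  then have "(\<integral>\<^sup>+(x::'a). ennreal (exp (- t * (norm x)\<^sup>2)) \<partial>lborel) =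
      (\<integral>\<^sup>+(x::'a). (\<Prod>b\<in>Basis. ennreal (exp (- t * (x \<bullet> b)\<^sup>2))) \<partial>lborel)"
    by (simp add: prod_ennreal)
  also have "\<dots> = (\<Prod>b\<in>(Basis::'a set). (\<integral>\<^sup>+x. ennreal (exp (- t * x\<^sup>2)) \<partial>lborel))"
    by (rule nn_integral_lborel_prod) auto
  also have "\<dots> = ennreal (sqrt (pi / t) ^ DIM('a))"
    by (simp only: nn_integral_gaussian_real[OF assms] prod_constant) (simp add: ennreal_power assms less_imp_le)
  also have "sqrt (pi / t) ^ DIM('a) = (pi / t) powr (DIM('a) / 2)"
    using assms by (simp add: powr_half_sqrt[symmetric] powr_powr flip: powr_realpow)
  finally show ?thesis .
qed

lemma nn_integral_Gamma_scaled:
  assumes "q > 0" "c > 0"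
  shows "(\<integral>\<^sup>+t. ennreal (indicator {0<..} t * (t powr (q - 1) * exp (- c * t))) \<partial>lborel) =
    ennreal (Gamma q * c powr (- q))"
proof -
  have "ennreal (Gamma q) = (\<integral>\<^sup>+t. ennreal (indicator {0..} t * t powr (q - 1) / exp t) \<partial>lborel)"
    by (rule Gamma_conv_nn_integral_real) fact
  also have "\<dots> = ennreal c * (\<integral>\<^sup>+t. ennreal (indicator {0..} (c * t) * (c * t) powr (q - 1) / exp (c * t)) \<partial>lborel)"
    by (subst nn_integral_real_affine[of _ c 0]) (use assms in auto)
  also have "(\<integral>\<^sup>+t. ennreal (indicator {0..} (c * t) * (c * t) powr (q - 1) / exp (c * t)) \<partial>lborel) =
      (\<integral>\<^sup>+t. ennreal (c powr (q - 1)) * ennreal (indicator {0<..} t * (t powr (q - 1) * exp (- c * t))) \<partial>lborel)"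
    by (rule nn_integral_cong)
       (use assms in \<open>auto simp: indicator_def powr_mult exp_minus field_simps zero_le_mult_iff
          ennreal_mult'[symmetric]\<close>)
  also have "\<dots> = ennreal (c powr (q - 1)) * (\<integral>\<^sup>+t. ennreal (indicator {0<..} t * (t powr (q - 1) * exp (- c * t))) \<partial>lborel)"
    by (rule nn_integral_cmult) auto
  finally have "ennreal (Gamma q) = ennreal (c powr q) * (\<integral>\<^sup>+t. ennreal (indicator {0<..} t * (t powr (q - 1) * exp (- c * t))) \<partial>lborel)"
    using assms by (simp add: mult.assoc[symmetric] ennreal_mult'[symmetric] powr_mult_base)
  then have "ennreal (c powr (- q)) * ennreal (Gamma q) = ennreal (c powr (- q) * c powr q) * (\<integral>\<^sup>+t. ennreal (indicator {0<..} t * (t powr (q - 1) * exp (- c * t))) \<partial>lborel)"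
    by (simp add: ennreal_mult' mult.assoc)
  also have "c powr (- q) * c powr q = 1"
    using assms by (simp add: powr_add[symmetric])
  finally show ?thesis using assms by (simp add: ennreal_mult'[symmetric] mult.commute)
qed

text \<open>
  Tonelli's theorem for a superposition of Gaussians with weight \<open>\<kappa>\<close>. The weight
  \<open>t powr (q / 2 - 1) * exp (- t)\<close> produces the bracket \<open>(1 + |x|^2) powr (- q / 2)\<close>, the weight
  \<open>t powr (q / 2 - 1)\<close> the pure power \<open>|x| powr (- q)\<close>, each up to the factor \<open>Gamma (q / 2)\<close>.
\<close>

lemma gaussian_superposition:
  fixes \<kappa> :: "real \<Rightarrow> real"
  assumes [measurable]: "\<kappa> \<in> borel_measurable borel" and "\<And>t. t > 0 \<Longrightarrow> \<kappa> t \<ge> 0"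
  shows "(\<integral>\<^sup>+(x::'a::euclidean_space). (\<integral>\<^sup>+t. ennreal (indicator {0<..} t * (\<kappa> t * exp (- t * (norm x)\<^sup>2))) \<partial>lborel) \<partial>lborel)
    = (\<integral>\<^sup>+t. ennreal (indicator {0<..} t * (\<kappa> t * (pi / t) powr (DIM('a) / 2))) \<partial>lborel)"
proof -
  have "(\<integral>\<^sup>+(x::'a). (\<integral>\<^sup>+t. ennreal (indicator {0<..} t * (\<kappa> t * exp (- t * (norm x)\<^sup>2))) \<partial>lborel) \<partial>lborel)
    = (\<integral>\<^sup>+t. (\<integral>\<^sup>+(x::'a). ennreal (indicator {0<..} t * (\<kappa> t * exp (- t * (norm x)\<^sup>2))) \<partial>lborel) \<partial>lborel)"
    by (rule lborel_pair.Fubini') measurable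
  also have "\<dots> = (\<integral>\<^sup>+t. ennreal (indicator {0<..} t * (\<kappa> t * (pi / t) powr (DIM('a) / 2))) \<partial>lborel)"
  proof (rule nn_integral_cong)
    fix t :: real
    show "(\<integral>\<^sup>+(x::'a). ennreal (indicator {0<..} t * (\<kappa> t * exp (- t * (norm x)\<^sup>2))) \<partial>lborel)
       = ennreal (indicator {0<..} t * (\<kappa> t * (pi / t) powr (DIM('a) / 2)))"
    proof (cases "t > 0")
      case True
      have "(\<integral>\<^sup>+(x::'a). ennreal (\<kappa> t * exp (- t * (norm x)\<^sup>2)) \<partial>lborel) =
          (\<integral>\<^sup>+(x::'a). ennreal (\<kappa> t) * ennreal (exp (- t * (norm x)\<^sup>2)) \<partial>lborel)"
        using assms(2)[OF True] by (simp add: ennreal_mult')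
      also have "\<dots> = ennreal (\<kappa> t) * ennreal ((pi / t) powr (DIM('a) / 2))"
        by (subst nn_integral_cmult) (simp_all only: nn_integral_gaussian[OF True], measurable)
      finally show ?thesis using True assms(2)[OF True] by (simp add: ennreal_mult')
    qed simp
  qed
  finally show ?thesis .
qed

lemma integrable_bracket_powr:
  fixes q :: real
  assumes q: "q > DIM('a::euclidean_space)"
  shows "integrable lborel (\<lambda>x::'a. (1 + (norm x)\<^sup>2) powr (- q / 2))"
proof -
  let ?N = "real DIM('a)"
  define \<kappa> where "\<kappa> t = t powr (q / 2 - 1) * exp (- t)" for t :: real
  have "q > 0" using q by (simp add: less_trans[OF _ q])
  have \<kappa>: "\<kappa> \<in> borel_measurable borel" unfolding \<kappa>_def by measurable
  have "(\<integral>\<^sup>+(x::'a). ennreal (Gamma (q/2) * (1 + (norm x)\<^sup>2) powr (- q / 2)) \<partial>lborel) =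
     (\<integral>\<^sup>+(x::'a). (\<integral>\<^sup>+t. ennreal (indicator {0<..} t * (\<kappa> t * exp (- t * (norm x)\<^sup>2))) \<partial>lborel) \<partial>lborel)"
  proof (rule nn_integral_cong)
    fix x :: 'a
    have "1 + (norm x)\<^sup>2 > 0" by (simp add: add_pos_nonneg)
    from nn_integral_Gamma_scaled[OF _ this, of "q/2"] \<open>q > 0\<close>
    show "ennreal (Gamma (q/2) * (1 + (norm x)\<^sup>2) powr (- q / 2)) =
      (\<integral>\<^sup>+t. ennreal (indicator {0<..} t * (\<kappa> t * exp (- t * (norm x)\<^sup>2))) \<partial>lborel)"
      by (simp add: \<kappa>_def mult.assoc mult_exp_exp) (simp add: algebra_simps)
  qed
  also have "\<dots> = (\<integral>\<^sup>+t. ennreal (indicator {0<..} t * (\<kappa> t * (pi / t) powr (?N / 2))) \<partial>lborel)"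
    by (rule gaussian_superposition) (auto simp: \<kappa>_def)
  also have "\<dots> = (\<integral>\<^sup>+t. ennreal (pi powr (?N / 2)) * ennreal (indicator {0<..} t * (t powr ((q - ?N) / 2 - 1) * exp (- 1 * t))) \<partial>lborel)"
  proof (rule nn_integral_cong)
    fix t :: real
    have "t powr (q / 2 - 1) * (pi / t) powr (?N / 2) = pi powr (?N / 2) * t powr ((q - ?N) / 2 - 1)" if "t > 0"
    proof -
      have "t powr (q / 2 - 1) = t powr ((q - ?N) / 2 - 1) * t powr (?N / 2)"
        by (simp add: powr_add[symmetric] diff_divide_distrib)
      then show ?thesis using that by (simp add: powr_divide)
    qed
    then show "ennreal (indicator {0<..} t * (\<kappa> t * (pi / t) powr (?N / 2))) =
      ennreal (pi powr (?N / 2)) * ennreal (indicator {0<..} t * (t powr ((q - ?N) / 2 - 1) * exp (- 1 * t)))"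
      by (cases "t > 0") (auto simp: \<kappa>_def ennreal_mult'[symmetric] mult_ac)
  qed
  also have "\<dots> = ennreal (pi powr (?N / 2)) * ennreal (Gamma ((q - ?N) / 2) * 1 powr (- ((q - ?N) / 2)))"
    by (subst nn_integral_cmult, measurable, subst nn_integral_Gamma_scaled) (use q in auto)
  also have "\<dots> < \<infinity>" by (simp add: ennreal_mult_less_top)
  finally have "integrable lborel (\<lambda>x::'a. Gamma (q/2) * (1 + (norm x)\<^sup>2) powr (- q / 2))"
    using \<open>q > 0\<close> by (intro integrableI_nonneg) (auto intro!: AE_I2 mult_nonneg_nonneg less_imp_le[OF Gamma_real_pos])
  then show ?thesis
    using \<open>q > 0\<close> Gamma_real_pos[of "q/2"] by (auto simp del: Gamma_real_pos)
qed

text \<open>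
  The integral is \<open>- Gamma (- s)\<close>, evaluated by writing \<open>1 - exp (- t)\<close> as the integral of
  \<open>exp (- \<tau>)\<close> over \<open>[0, t]\<close> and exchanging the integrations.
\<close>

lemma nn_integral_one_minus_exp:
  fixes s :: real
  assumes "0 < s" "s < 1"
  shows "(\<integral>\<^sup>+t. ennreal (indicator {0<..} t * (t powr (- s - 1) * (1 - exp (- t)))) \<partial>lborel) =
    ennreal (Gamma (1 - s) / s)"
proof -
  have exp: "(\<integral>\<^sup>+\<tau>. ennreal (indicator {0..t} \<tau> * exp (- \<tau>)) \<partial>lborel) = ennreal (1 - exp (- t))" if "t > 0" for t :: real
  proof -
    have "(\<integral>\<^sup>+\<tau>. ennreal (exp (- \<tau>)) * indicator {0..t} \<tau> \<partial>lborel) = ennreal (- exp (- t) - (- exp (- 0)))"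
      by (rule nn_integral_FTC_Icc) (use that in \<open>auto intro!: derivative_eq_intros\<close>)
    then show ?thesis by (simp add: ennreal_mult' ennreal_indicator mult.commute)
  qed
  have pow: "(\<integral>\<^sup>+t. ennreal (indicator {\<tau>..} t * t powr (- s - 1)) \<partial>lborel) = ennreal (\<tau> powr (- s) / s)" if "\<tau> > 0" for \<tau> :: real
  proof -
    have "((\<lambda>t. - (t powr (- s)) / s) \<longlongrightarrow> - 0 / s) at_top"
      using assms by (intro tendsto_intros tendsto_neg_powr filterlim_ident) auto
    then have "(\<integral>\<^sup>+t. ennreal (t powr (- s - 1)) * indicator {\<tau>..} t \<partial>lborel) = ennreal (0 - (- (\<tau> powr (- s)) / s))"
      by (intro nn_integral_FTC_atLeast) (use that assms in \<open>auto intro!: derivative_eq_intros simp: field_simps\<close>)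
    then show ?thesis by (simp add: ennreal_mult' ennreal_indicator mult.commute)
  qed
  have "(\<integral>\<^sup>+t. ennreal (indicator {0<..} t * (t powr (- s - 1) * (1 - exp (- t)))) \<partial>lborel) =
     (\<integral>\<^sup>+t. (\<integral>\<^sup>+\<tau>. ennreal (indicator {0<..} t * t powr (- s - 1) * (indicator {0..t} \<tau> * exp (- \<tau>))) \<partial>lborel) \<partial>lborel)"
  proof (rule nn_integral_cong)
    fix t :: real
    show "ennreal (indicator {0<..} t * (t powr (- s - 1) * (1 - exp (- t)))) =
      (\<integral>\<^sup>+\<tau>. ennreal (indicator {0<..} t * t powr (- s - 1) * (indicator {0..t} \<tau> * exp (- \<tau>))) \<partial>lborel)"
    proof (cases "t > 0")
      case True
      have "(\<integral>\<^sup>+\<tau>. ennreal (t powr (- s - 1) * (indicator {0..t} \<tau> * exp (- \<tau>))) \<partial>lborel) =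
        (\<integral>\<^sup>+\<tau>. ennreal (t powr (- s - 1)) * ennreal (indicator {0..t} \<tau> * exp (- \<tau>)) \<partial>lborel)"
        by (simp add: ennreal_mult')
      also have "\<dots> = ennreal (t powr (- s - 1)) * ennreal (1 - exp (- t))"
        by (subst nn_integral_cmult) (auto simp: exp[OF True])
      finally show ?thesis using True by (simp add: ennreal_mult')
    qed simp
  qed
  also have "\<dots> = (\<integral>\<^sup>+\<tau>. (\<integral>\<^sup>+t. ennreal (indicator {0<..} t * t powr (- s - 1) * (indicator {0..t} \<tau> * exp (- \<tau>))) \<partial>lborel) \<partial>lborel)"
    by (rule lborel_pair.Fubini') (simp add: indicator_def split_beta' measurable_split_conv)
  also have "\<dots> = (\<integral>\<^sup>+\<tau>. ennreal (1 / s) * ennreal (indicator {0<..} \<tau> * (\<tau> powr ((1 - s) - 1) * exp (- 1 * \<tau>))) \<partial>lborel)"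
  proof (rule nn_integral_cong_AE, use AE_lborel_singleton[of "0::real"] in eventually_elim)
    fix \<tau> :: real assume "\<tau> \<noteq> 0"
    show "(\<integral>\<^sup>+t. ennreal (indicator {0<..} t * t powr (- s - 1) * (indicator {0..t} \<tau> * exp (- \<tau>))) \<partial>lborel) =
      ennreal (1 / s) * ennreal (indicator {0<..} \<tau> * (\<tau> powr ((1 - s) - 1) * exp (- 1 * \<tau>)))"
    proof (cases "\<tau> > 0")
      case True
      have "(\<integral>\<^sup>+t. ennreal (indicator {0<..} t * t powr (- s - 1) * (indicator {0..t} \<tau> * exp (- \<tau>))) \<partial>lborel) =
        (\<integral>\<^sup>+t. ennreal (exp (- \<tau>)) * ennreal (indicator {\<tau>..} t * t powr (- s - 1)) \<partial>lborel)"
        by (rule nn_integral_cong) (use True in \<open>auto simp: ennreal_mult'[symmetric] indicator_def\<close>)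
      also have "\<dots> = ennreal (exp (- \<tau>)) * ennreal (\<tau> powr (- s) / s)"
        by (subst nn_integral_cmult) (auto simp: pow[OF True])
      finally show ?thesis using True assms by (simp add: ennreal_mult'[symmetric] mult_ac)
    qed (use \<open>\<tau> \<noteq> 0\<close> in \<open>simp add: indicator_def\<close>)
  qed
  also have "\<dots> = ennreal (1 / s) * ennreal (Gamma (1 - s) * 1 powr (- (1 - s)))"
    by (subst nn_integral_cmult, measurable, subst nn_integral_Gamma_scaled) (use assms in auto)
  finally show ?thesis using assms by (simp add: ennreal_mult'[symmetric])
qed

text \<open>
  Neither power is integrable by itself: the difference gains two orders of decay at infinity. Its
  integral is the only one that has to be evaluated in the proof.
\<close>

lemma has_bochner_integral_powr_minus_bracket:
  fixes s :: real
  assumes s: "0 < s" "s < 1" "2 * s < DIM('a::euclidean_space)"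
  defines "p \<equiv> DIM('a) - 2 * s"
  shows "has_bochner_integral lborel (\<lambda>x::'a. norm x powr (- p) - (1 + (norm x)\<^sup>2) powr (- p / 2))
    (pi powr (DIM('a) / 2) * Gamma (1 - s) / (s * Gamma (DIM('a) / 2 - s)))"
proof -
  let ?N = "real DIM('a)"
  define \<kappa> where "\<kappa> t = t powr (p / 2 - 1) * (1 - exp (- t))" for t :: real
  define C where "C = pi powr (?N / 2) * (Gamma (1 - s) / s)"
  have p: "p > 0" using s by (simp add: p_def)
  have G: "Gamma (p / 2) > 0" using p by (simp add: Gamma_real_pos)
  have \<kappa>: "\<kappa> \<in> borel_measurable borel" unfolding \<kappa>_def by measurable
  have le: "(1 + (norm x)\<^sup>2) powr (- p / 2) \<le> norm x powr (- p)" if "x \<noteq> 0" for x :: 'a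
  proof -
    have "(1 + (norm x)\<^sup>2) powr (- p / 2) \<le> ((norm x)\<^sup>2) powr (- p / 2)"
      by (rule powr_mono2') (use that p in auto)
    also have "\<dots> = norm x powr (- p)"
      using that by (simp add: powr_powr flip: powr_numeral)
    finally show ?thesis .
  qed
  have "(\<integral>\<^sup>+(x::'a). ennreal (Gamma (p/2) * (norm x powr (- p) - (1 + (norm x)\<^sup>2) powr (- p / 2))) \<partial>lborel) =
     (\<integral>\<^sup>+(x::'a). (\<integral>\<^sup>+t. ennreal (indicator {0<..} t * (\<kappa> t * exp (- t * (norm x)\<^sup>2))) \<partial>lborel) \<partial>lborel)"
  proof (rule nn_integral_cong_AE, use AE_lborel_singleton[of "0::'a"] in eventually_elim)
    fix x :: 'a assume x: "x \<noteq> 0"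
    define A where "A c = (\<integral>\<^sup>+t. ennreal (indicator {0<..} t * (t powr (p/2 - 1) * exp (- c * t))) \<partial>lborel)" for c :: real
    have A: "A c = ennreal (Gamma (p/2) * c powr (- p / 2))" if "c > 0" for c
      using nn_integral_Gamma_scaled[of "p/2" c] that p by (simp add: A_def)
    have pos: "1 + (norm x)\<^sup>2 > 0" "(norm x)\<^sup>2 > 0" using x by (auto simp: add_pos_nonneg)
    have "(\<integral>\<^sup>+t. ennreal (indicator {0<..} t * (\<kappa> t * exp (- t * (norm x)\<^sup>2))) \<partial>lborel) + A (1 + (norm x)\<^sup>2) = A ((norm x)\<^sup>2)"
      unfolding A_def
    proof (subst nn_integral_add[symmetric])
      show "(\<integral>\<^sup>+t. ennreal (indicator {0<..} t * (\<kappa> t * exp (- t * (norm x)\<^sup>2))) +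
          ennreal (indicator {0<..} t * (t powr (p/2 - 1) * exp (- (1 + (norm x)\<^sup>2) * t))) \<partial>lborel) =
        (\<integral>\<^sup>+t. ennreal (indicator {0<..} t * (t powr (p/2 - 1) * exp (- ((norm x)\<^sup>2) * t))) \<partial>lborel)"
      proof (rule nn_integral_cong)
        fix t :: real
        have "exp (- (1 + (norm x)\<^sup>2) * t) = exp (- t) * exp (- (norm x)\<^sup>2 * t)"
          by (simp add: mult_exp_exp algebra_simps)
        then show "ennreal (indicator {0<..} t * (\<kappa> t * exp (- t * (norm x)\<^sup>2))) +
          ennreal (indicator {0<..} t * (t powr (p/2 - 1) * exp (- (1 + (norm x)\<^sup>2) * t))) =
          ennreal (indicator {0<..} t * (t powr (p/2 - 1) * exp (- ((norm x)\<^sup>2) * t)))"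
          by (cases "t > 0") (auto simp: \<kappa>_def ennreal_plus[symmetric] algebra_simps simp del: ennreal_plus)
      qed
    qed (use \<kappa> in measurable)
    then have sum: "(\<integral>\<^sup>+t. ennreal (indicator {0<..} t * (\<kappa> t * exp (- t * (norm x)\<^sup>2))) \<partial>lborel) +
        ennreal (Gamma (p/2) * (1 + (norm x)\<^sup>2) powr (- p / 2)) = ennreal (Gamma (p/2) * ((norm x)\<^sup>2) powr (- p / 2))"
      unfolding A[OF pos(1)] A[OF pos(2)] .
    have "(\<integral>\<^sup>+t. ennreal (indicator {0<..} t * (\<kappa> t * exp (- t * (norm x)\<^sup>2))) \<partial>lborel) =
        ennreal (Gamma (p/2) * ((norm x)\<^sup>2) powr (- p / 2)) - ennreal (Gamma (p/2) * (1 + (norm x)\<^sup>2) powr (- p / 2))"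
      unfolding sum[symmetric] by (simp only: ennreal_add_diff_cancel_right[OF ennreal_neq_top])
    also have "\<dots> = ennreal (Gamma (p/2) * (norm x powr (- p) - (1 + (norm x)\<^sup>2) powr (- p / 2)))"
    proof -
      have "((norm x)\<^sup>2) powr (- p / 2) = norm x powr (- p)"
        using x by (simp add: powr_powr flip: powr_numeral)
      then show ?thesis using G by (simp add: ennreal_minus right_diff_distrib)
    qed
    finally show "ennreal (Gamma (p/2) * (norm x powr (- p) - (1 + (norm x)\<^sup>2) powr (- p / 2))) =
      (\<integral>\<^sup>+t. ennreal (indicator {0<..} t * (\<kappa> t * exp (- t * (norm x)\<^sup>2))) \<partial>lborel)" by simp
  qed
  also have "\<dots> = (\<integral>\<^sup>+t. ennreal (indicator {0<..} t * (\<kappa> t * (pi / t) powr (?N / 2))) \<partial>lborel)"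
    by (rule gaussian_superposition[OF \<kappa>]) (auto simp: \<kappa>_def)
  also have "\<dots> = (\<integral>\<^sup>+t. ennreal (pi powr (?N / 2)) * ennreal (indicator {0<..} t * (t powr (- s - 1) * (1 - exp (- t)))) \<partial>lborel)"
  proof (rule nn_integral_cong)
    fix t :: real
    have "t powr (p / 2 - 1) * (pi / t) powr (?N / 2) = pi powr (?N / 2) * t powr (- s - 1)" if "t > 0"
    proof -
      have "p / 2 - 1 = (- s - 1) + ?N / 2" by (simp add: p_def diff_divide_distrib)
      then have "t powr (p / 2 - 1) = t powr (- s - 1) * t powr (?N / 2)"
        by (simp only: powr_add)
      then show ?thesis using that by (simp add: powr_divide)
    qed
    then show "ennreal (indicator {0<..} t * (\<kappa> t * (pi / t) powr (?N / 2))) =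
      ennreal (pi powr (?N / 2)) * ennreal (indicator {0<..} t * (t powr (- s - 1) * (1 - exp (- t))))"
      by (cases "t > 0") (auto simp: \<kappa>_def ennreal_mult'[symmetric] mult_ac)
  qed
  also have "\<dots> = ennreal C"
    by (subst nn_integral_cmult, measurable, subst nn_integral_one_minus_exp) (use s in \<open>auto simp: C_def ennreal_mult'[symmetric]\<close>)
  finally have "has_bochner_integral lborel
      (\<lambda>x::'a. Gamma (p/2) * (norm x powr (- p) - (1 + (norm x)\<^sup>2) powr (- p / 2))) C"
  proof (intro has_bochner_integral_nn_integral)
    show "AE x::'a in lborel. 0 \<le> Gamma (p/2) * (norm x powr (- p) - (1 + (norm x)\<^sup>2) powr (- p / 2))"
      using AE_lborel_singleton[of "0::'a"]
      by eventually_elim (use G le in \<open>auto intro!: mult_nonneg_nonneg\<close>)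
    show "0 \<le> C" using s by (auto simp: C_def intro!: mult_nonneg_nonneg divide_nonneg_pos less_imp_le[OF Gamma_real_pos])
  qed auto
  then have "has_bochner_integral lborel
      (\<lambda>x::'a. (1 / Gamma (p/2)) * (Gamma (p/2) * (norm x powr (- p) - (1 + (norm x)\<^sup>2) powr (- p / 2)))) (1 / Gamma (p/2) * C)"
    by (intro has_bochner_integral_mult_right) auto
  also have "(\<lambda>x::'a. (1 / Gamma (p/2)) * (Gamma (p/2) * (norm x powr (- p) - (1 + (norm x)\<^sup>2) powr (- p / 2)))) =
      (\<lambda>x. norm x powr (- p) - (1 + (norm x)\<^sup>2) powr (- p / 2))"
    using G by simp
  also have "1 / Gamma (p/2) * C = pi powr (?N / 2) * Gamma (1 - s) / (s * Gamma (?N / 2 - s))"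
    by (simp add: C_def p_def diff_divide_distrib)
  finally show ?thesis .
qed

section \<open>Integrals over large balls\<close>

lemma power_diff_le:
  fixes a b :: real
  assumes "0 \<le> a" "a \<le> b"
  shows "b ^ n - a ^ n \<le> real n * (b - a) * b ^ (n - 1)"
proof (cases "n = 0")
  case False
  have "b ^ n - a ^ n = (b - a) * (\<Sum>i<n. a ^ (n - Suc i) * b ^ i)"
    by (rule power_diff_sumr2)
  also have "\<dots> \<le> (b - a) * (\<Sum>i<n. b ^ (n - 1))"
  proof (intro mult_left_mono sum_mono)
    fix i assume "i \<in> {..<n}"
    then have "b ^ (n - 1) = b ^ (n - Suc i) * b ^ i"
      by (simp add: power_add[symmetric])
    then show "a ^ (n - Suc i) * b ^ i \<le> b ^ (n - 1)"
      using assms by (auto intro!: mult_right_mono power_mono)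
  qed (use assms in simp)
  finally show ?thesis using assms by (simp add: mult_left_mono mult_ac)
qed simp

lemma measure_shell_le:
  fixes c R :: real
  assumes "0 \<le> c" "c \<le> R"
  defines "S \<equiv> {x::'a::euclidean_space. R - c \<le> norm x \<and> norm x \<le> R + c}"
  shows "S \<in> sets borel" and "emeasure lborel S < \<infinity>"
    and "measure lborel S \<le> unit_ball_vol DIM('a) * (real DIM('a) * (2 * c) * (R + c) ^ (DIM('a) - 1))"
proof -
  have S: "S = cball 0 (R + c) - ball 0 (R - c)"
    by (auto simp: S_def)
  show Sb: "S \<in> sets borel" by (simp add: S)
  have "emeasure lborel S \<le> emeasure lborel (cball (0::'a) (R + c))"
    by (rule emeasure_mono) (auto simp: S)
  also have "\<dots> < \<infinity>" using assms by (simp add: emeasure_cball)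
  finally show "emeasure lborel S < \<infinity>" .
  have "measure lborel S = measure lborel (cball (0::'a) (R + c)) - measure lborel (ball (0::'a) (R - c))"
    unfolding S by (rule measure_Diff) (use assms in \<open>auto simp: emeasure_cball\<close>)
  also have "\<dots> = unit_ball_vol DIM('a) * ((R + c) ^ DIM('a) - (R - c) ^ DIM('a))"
    using assms by (simp add: content_cball content_ball right_diff_distrib)
  also have "\<dots> \<le> unit_ball_vol DIM('a) * (real DIM('a) * (2 * c) * (R + c) ^ (DIM('a) - 1))"
    using power_diff_le[of "R - c" "R + c" "DIM('a)"] assms
    by (intro mult_left_mono) auto
  finally show "measure lborel S \<le> unit_ball_vol DIM('a) * (real DIM('a) * (2 * c) * (R + c) ^ (DIM('a) - 1))" .
qed

text \<open>
  The two balls have the same volume, so any constant \<open>k\<close> may be subtracted from \<open>f\<close>; what is left lives on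
  the shell that contains their symmetric difference.
\<close>

lemma shifted_ball_integral_diff:
  fixes f :: "'a::euclidean_space \<Rightarrow> real"
  assumes int: "\<And>R. set_integrable lborel (cball 0 R) f"
    and R: "norm x \<le> R"
    and bound: "\<And>y. R - norm x \<le> norm y \<Longrightarrow> norm y \<le> R + norm x \<Longrightarrow> \<bar>f y - k\<bar> \<le> M"
  shows "\<bar>(LINT y:cball x R|lborel. f y) - (LINT y:cball 0 R|lborel. f y)\<bar>
    \<le> M * (unit_ball_vol DIM('a) * (real DIM('a) * (2 * norm x) * (R + norm x) ^ (DIM('a) - 1)))"
proof -
  define S where "S = {y::'a. R - norm x \<le> norm y \<and> norm y \<le> R + norm x}"
  have S: "S \<in> sets borel" "emeasure lborel S < \<infinity>"
    "measure lborel S \<le> unit_ball_vol DIM('a) * (real DIM('a) * (2 * norm x) * (R + norm x) ^ (DIM('a) - 1))"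
    unfolding S_def using measure_shell_le[of "norm x" R, where 'a='a] R by auto
  have R0: "R \<ge> 0" using R norm_ge_zero order_trans by blast
  have M: "M \<ge> 0"
  proof -
    obtain b :: 'a where b: "b \<in> Basis" by (meson nonempty_Basis ex_in_conv)
    have "\<bar>f (R *\<^sub>R b) - k\<bar> \<le> M"
      by (rule bound) (use b R0 in auto)
    then show ?thesis by linarith
  qed
  have sub: "cball x R \<subseteq> cball 0 (R + norm x)"
    by (auto simp: dist_norm) (metis add.commute add_mono_thms_linordered_semiring(3) norm_minus_commute norm_triangle_sub order_trans)
  have i1: "set_integrable lborel (cball x R) f"
    by (rule set_integrable_subset[OF int _ sub]) simp
  have k: "set_integrable lborel (cball c R) (\<lambda>_. k)" for c :: 'a
    unfolding set_integrable_def by (rule integrable_scaleR_left, rule integrable_real_indicator) (use R0 in \<open>auto simp: emeasure_cball\<close>)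
  have shift: "(LINT y:cball c R|lborel. f y) = (LINT y:cball c R|lborel. f y - k) + k * (unit_ball_vol DIM('a) * R ^ DIM('a))"
    if "set_integrable lborel (cball c R) f" for c
  proof -
    have "(LINT y:cball c R|lborel. k) = k * (unit_ball_vol DIM('a) * R ^ DIM('a))"
      using R0 by (simp add: set_lebesgue_integral_def content_cball)
    then show ?thesis using set_integral_diff(2)[OF that k] by simp
  qed
  have d: "set_integrable lborel (cball c R) (\<lambda>y. f y - k)" if "set_integrable lborel (cball c R) f" for c
    by (rule set_integral_diff(1)[OF that k])
  have "\<bar>(LINT y:cball x R|lborel. f y) - (LINT y:cball 0 R|lborel. f y)\<bar> =
      \<bar>(\<integral>y. indicator (cball x R) y *\<^sub>R (f y - k) - indicator (cball 0 R) y *\<^sub>R (f y - k) \<partial>lborel)\<bar>"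
    using d[OF i1] d[OF int] unfolding shift[OF i1] shift[OF int]
    by (simp add: set_lebesgue_integral_def set_integrable_def)
  also have "\<dots> \<le> (\<integral>y. M * indicator S y \<partial>lborel)"
  proof (rule integral_abs_bound[THEN order_trans], rule integral_mono)
    show "integrable lborel (\<lambda>y. \<bar>indicator (cball x R) y *\<^sub>R (f y - k) - indicator (cball 0 R) y *\<^sub>R (f y - k)\<bar>)"
      using d[OF i1] d[OF int] unfolding set_integrable_def by (intro integrable_abs Bochner_Integration.integrable_diff)
    show "integrable lborel (\<lambda>y. M * indicator S y)"
      using S by (intro integrable_mult_right integrable_real_indicator) auto
    fix y :: 'a
    show "\<bar>indicator (cball x R) y *\<^sub>R (f y - k) - indicator (cball 0 R) y *\<^sub>R (f y - k)\<bar> \<le> M * indicator S y"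
    proof (cases "y \<in> cball x R \<longleftrightarrow> y \<in> cball 0 R")
      case True
      then show ?thesis using M by (simp add: indicator_def)
    next
      case False
      have "norm y \<le> norm (x - y) + norm x" "norm (x - y) \<le> norm x + norm y"
        by (metis norm_minus_commute norm_triangle_sub add.commute, rule norm_triangle_ineq4)
      then have "y \<in> S"
        using False by (auto simp: S_def dist_norm)
      moreover from this have "\<bar>f y - k\<bar> \<le> M" by (auto simp: S_def intro: bound)
      ultimately show ?thesis using False by (auto simp: indicator_def)
    qed
  qed
  also have "\<dots> = M * measure lborel S" using S by simp
  also have "\<dots> \<le> M * (unit_ball_vol DIM('a) * (real DIM('a) * (2 * norm x) * (R + norm x) ^ (DIM('a) - 1)))"
    by (rule mult_left_mono[OF S(3) M])
  finally show ?thesis .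
qed

lemma shifted_ball_integral_limit:
  fixes f :: "'a::euclidean_space \<Rightarrow> real" and k :: "real \<Rightarrow> real" and \<alpha> C :: real
  assumes int: "\<And>R. set_integrable lborel (cball 0 R) f"
    and \<alpha>: "\<alpha> > real DIM('a) - 1"
    and bound: "\<And>R y. 2 * norm x + 1 \<le> R \<Longrightarrow> R - norm x \<le> norm y \<Longrightarrow> norm y \<le> R + norm x
      \<Longrightarrow> \<bar>f y - k R\<bar> \<le> C * R powr (- \<alpha>)"
  shows "((\<lambda>R. (LINT y:cball x R|lborel. f y) - (LINT y:cball 0 R|lborel. f y)) \<longlongrightarrow> 0) at_top"
proof (rule Lim_null_comparison)
  let ?N = "DIM('a)"
  define D where "D = C * (unit_ball_vol ?N * (real ?N * (2 * norm x) * 2 ^ (?N - 1)))"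
  show "((\<lambda>R. D * R powr (real (?N - 1) - \<alpha>)) \<longlongrightarrow> 0) at_top"
    using \<alpha> by (intro tendsto_mult_right_zero tendsto_neg_powr filterlim_ident) (auto simp: of_nat_diff)
  have C: "C \<ge> 0"
  proof -
    define R where "R = 2 * norm x + 1"
    have R0: "R > 0" by (simp add: R_def add_nonneg_pos)
    obtain b :: 'a where b: "b \<in> Basis" by (meson nonempty_Basis ex_in_conv)
    have "\<bar>f (R *\<^sub>R b) - k R\<bar> \<le> C * R powr (- \<alpha>)"
      by (rule bound) (use b R0 in \<open>auto simp: R_def\<close>)
    then have "0 \<le> C * R powr (- \<alpha>)" by linarith
    then show ?thesis using R0 by (simp add: zero_le_mult_iff)
  qed
  have "\<bar>(LINT y:cball x R|lborel. f y) - (LINT y:cball 0 R|lborel. f y)\<bar> \<le> D * R powr (real (?N - 1) - \<alpha>)"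
    if R: "2 * norm x + 1 \<le> R" for R
  proof -
    have R0: "R > 0" "norm x \<le> R" using R norm_ge_zero[of x] by linarith+
    have "\<bar>(LINT y:cball x R|lborel. f y) - (LINT y:cball 0 R|lborel. f y)\<bar> \<le>
      (C * R powr (- \<alpha>)) * (unit_ball_vol ?N * (real ?N * (2 * norm x) * (R + norm x) ^ (?N - 1)))"
      by (rule shifted_ball_integral_diff[OF int R0(2) bound[OF R]])
    also have "\<dots> \<le> (C * R powr (- \<alpha>)) * (unit_ball_vol ?N * (real ?N * (2 * norm x) * (2 * R) ^ (?N - 1)))"
      using C R0 by (intro mult_left_mono power_mono) auto
    also have "\<dots> = D * R powr (real (?N - 1) - \<alpha>)"
    proof -
      have "R powr (- \<alpha>) * R ^ (?N - 1) = R powr (real (?N - 1) - \<alpha>)"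
        using R0 by (simp add: powr_realpow[symmetric] powr_add[symmetric] del: of_nat_diff)
      then show ?thesis by (simp add: D_def power_mult_distrib mult_ac)
    qed
    finally show ?thesis .
  qed
  then show "\<forall>\<^sub>F R in at_top. norm ((LINT y:cball x R|lborel. f y) - (LINT y:cball 0 R|lborel. f y)) \<le> D * R powr (real (?N - 1) - \<alpha>)"
    unfolding eventually_at_top_linorder by (intro exI[of _ "2 * norm x + 1"]) auto
qed

lemma ball_integral_tendsto:
  fixes f :: "'a::euclidean_space \<Rightarrow> real"
  assumes f: "integrable lborel f"
  shows "((\<lambda>R. LINT y:cball 0 R|lborel. f y) \<longlongrightarrow> integral\<^sup>L lborel f) at_top"
  unfolding set_lebesgue_integral_def
proof (rule integral_dominated_convergence_at_top[where w="\<lambda>y. norm (f y)"])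
  show "AE y in lborel. ((\<lambda>R. indicator (cball 0 R) y *\<^sub>R f y) \<longlongrightarrow> f y) at_top"
  proof (rule AE_I2, rule tendsto_eventually)
    fix y :: 'a
    show "\<forall>\<^sub>F R in at_top. indicator (cball 0 R) y *\<^sub>R f y = f y"
      using eventually_ge_at_top[of "norm y"] by eventually_elim simp
  qed
qed (use f in \<open>auto intro!: always_eventually AE_I2 simp: indicator_def\<close>)

lemma set_integral_cball_reflect:
  fixes f :: "'a::euclidean_space \<Rightarrow> real"
  assumes "set_integrable lborel (cball 0 R) f" and [measurable]: "f \<in> borel_measurable borel"
  shows "set_integrable lborel (cball 0 R) (\<lambda>y. f (- y))"
    and "(LINT y:cball 0 R|lborel. f (- y)) = (LINT y:cball 0 R|lborel. f y)"
proof -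
  have "has_bochner_integral lborel (\<lambda>y. indicator (cball 0 R) y *\<^sub>R f y) (LINT y:cball 0 R|lborel. f y)"
    using assms(1) by (simp add: set_integrable_def set_lebesgue_integral_def has_bochner_integral_integrable)
  then have "has_bochner_integral lborel (\<lambda>y. indicator (cball 0 R) (- y) *\<^sub>R f (- y)) (LINT y:cball 0 R|lborel. f y)"
    by (rule has_bochner_integral_reflect[THEN iffD1, rotated])
       (intro borel_measurable_scaleR borel_measurable_indicator, auto)
  also have "(\<lambda>y. indicator (cball 0 R) (- y) *\<^sub>R f (- y)) = (\<lambda>y. indicator (cball 0 R) y *\<^sub>R f (- y))"
    by (auto simp: indicator_def)
  finally show "set_integrable lborel (cball 0 R) (\<lambda>y. f (- y))"
    and "(LINT y:cball 0 R|lborel. f (- y)) = (LINT y:cball 0 R|lborel. f y)"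
    by (auto simp: set_integrable_def set_lebesgue_integral_def has_bochner_integral_iff)
qed

text \<open>
  The odd part cancels on every ball, so only the even part has to be integrable.
\<close>

lemma even_part_ball_integral_tendsto:
  fixes f :: "'a::euclidean_space \<Rightarrow> real"
  assumes int: "\<And>R. set_integrable lborel (cball 0 R) f" and f [measurable]: "f \<in> borel_measurable borel"
    and even: "integrable lborel (\<lambda>y. f y + f (- y))"
  shows "((\<lambda>R. LINT y:cball 0 R|lborel. f y) \<longlongrightarrow> (\<integral>y. f y + f (- y) \<partial>lborel) / 2) at_top"
proof -
  have "(LINT y:cball 0 R|lborel. f y + f (- y)) / 2 = (LINT y:cball 0 R|lborel. f y)" for R
    using set_integral_add(2)[OF int[of R] set_integral_cball_reflect(1)[OF int f]]
      set_integral_cball_reflect(2)[OF int[of R] f] by simp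
  with tendsto_divide[OF ball_integral_tendsto[OF even] tendsto_const[of 2]]
  show ?thesis by simp
qed

section \<open>Stereographic projection and the chart centred at the antipode\<close>

lemma one_plus_norm_sq_pos: "1 + (norm y)\<^sup>2 > 0" by (simp add: add_pos_nonneg)

text \<open>
  The conformal factor of the stereographic parametrization: the round metric is
  \<open>(conf_factor y)^2\<close> times the Euclidean metric.
\<close>

definition conf_factor :: "'a::real_normed_vector \<Rightarrow> real" where
  "conf_factor y = 2 / (1 + (norm y)\<^sup>2)"

lemma conf_factor_pos: "conf_factor y > 0"
  using one_plus_norm_sq_pos[of y] by (simp add: conf_factor_def)

lemma conf_factor_norm_sq: "conf_factor y * (norm y)\<^sup>2 = 2 - conf_factor y"
  using one_plus_norm_sq_pos[of y] by (simp add: conf_factor_def field_simps)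

lemma norm_eq_1I: "(norm x)\<^sup>2 = 1 \<Longrightarrow> norm x = 1"
  using real_sqrt_unique[of "norm x" 1] by simp

lemma norm_stereo_param:
  fixes y :: "'a::real_inner"
  shows "norm (conf_factor y *\<^sub>R y, conf_factor y - 1) = 1"
proof (rule norm_eq_1I)
  have "(norm (conf_factor y *\<^sub>R y, conf_factor y - 1))\<^sup>2 =
      conf_factor y * (conf_factor y * (norm y)\<^sup>2) + (conf_factor y - 1)\<^sup>2"
    unfolding power2_norm_eq_inner by (simp add: power2_eq_square)
  also have "\<dots> = 1"
    unfolding conf_factor_norm_sq by (simp add: power2_eq_square algebra_simps)
  finally show "(norm (conf_factor y *\<^sub>R y, conf_factor y - 1))\<^sup>2 = 1" .
qed

lemma stereo_param_stereo:
  assumes z: "z \<in> unit_sphere - {- north}"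
  shows "(conf_factor (stereo z) *\<^sub>R stereo z, conf_factor (stereo z) - 1) = z"
proof -
  obtain p t where zz: "z = (p, t)" by (cases z)
  have n: "(norm p)\<^sup>2 + t\<^sup>2 = 1" using z by (auto simp: zz norm_Pair)
  have "t \<noteq> -1"
  proof
    assume "t = -1"
    then have "p = 0" using n by simp
    then show False using z \<open>t = -1\<close> by (auto simp: zz north_def)
  qed
  then have t: "1 + t \<noteq> 0" by simp
  have "1 + (norm (p /\<^sub>R (1 + t)))\<^sup>2 = 1 + (norm p)\<^sup>2 / (1 + t)\<^sup>2"
    by (simp add: power_mult_distrib field_simps)
  also have "(norm p)\<^sup>2 = (1 + t) * (1 - t)"
    using n by (simp add: algebra_simps power2_eq_square)
  also have "(1 + t) * (1 - t) / (1 + t)\<^sup>2 = (1 - t) / (1 + t)"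
    using t by (simp add: power2_eq_square)
  also have "1 + (1 - t) / (1 + t) = 2 / (1 + t)"
    using t by (simp add: field_simps)
  finally have "conf_factor (p /\<^sub>R (1 + t)) = 1 + t"
    using t by (simp add: conf_factor_def)
  then show ?thesis using t by (simp add: stereo_def zz)
qed

lemma stereo_inv_eq: "stereo_inv y = (conf_factor y *\<^sub>R y, conf_factor y - 1)"
  unfolding stereo_inv_def
proof (rule inv_into_f_eq)
  show "inj_on stereo (unit_sphere - {- north :: (real^'n) \<times> real})"
    by (rule inj_on_inverseI[where g="\<lambda>y. (conf_factor y *\<^sub>R y, conf_factor y - 1)"])
       (rule stereo_param_stereo)
  show "(conf_factor y *\<^sub>R y, conf_factor y - 1) \<in> unit_sphere - {- north}"
    using conf_factor_pos[of y] norm_stereo_param[of y] by (auto simp: north_def)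
  show "stereo (conf_factor y *\<^sub>R y, conf_factor y - 1) = y"
    using conf_factor_pos[of y] by (simp add: stereo_def)
qed

lemma stereo_inv_stereo: "z \<in> unit_sphere - {- north} \<Longrightarrow> stereo_inv (stereo z) = z"
  by (simp only: stereo_inv_eq stereo_param_stereo)

lemma norm_stereo_inv: "norm (stereo_inv y) = 1"
  by (simp only: stereo_inv_eq norm_stereo_param)

lemma has_derivative_conf_factor:
  fixes y :: "'a::real_inner"
  shows "(conf_factor has_derivative (\<lambda>h. - (conf_factor y)\<^sup>2 * (y \<bullet> h))) (at y)"
proof -
  have "((\<lambda>y. 2 / (1 + y \<bullet> y)) has_derivative (\<lambda>h. - (4 * (y \<bullet> h)) / (1 + y \<bullet> y)\<^sup>2)) (at y)"
  proof -
    have "1 + y \<bullet> y \<noteq> 0" using inner_ge_zero[of y] by linarith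
    then show ?thesis
      by (auto intro!: derivative_eq_intros simp: inner_commute field_simps power2_eq_square)
  qed
  then show ?thesis
    by (simp add: conf_factor_def[abs_def] power2_norm_eq_inner power_divide)
qed

lemma has_derivative_stereo_inv:
  "(stereo_inv has_derivative
    (\<lambda>h. (conf_factor y *\<^sub>R h - ((conf_factor y)\<^sup>2 * (y \<bullet> h)) *\<^sub>R y, - (conf_factor y)\<^sup>2 * (y \<bullet> h)))) (at y)"
  unfolding stereo_inv_eq[abs_def]
  by (auto intro!: derivative_eq_intros has_derivative_conf_factor)

lemma sqrt_det_induced_metric:
  fixes y :: "real^'n"
  shows "sqrt (det (induced_metric stereo_inv y)) = conf_factor y ^ CARD('n)"
proof -
  define r where "r = conf_factor y"
  have fd: "frechet_derivative stereo_inv (at y) =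
     (\<lambda>h. (r *\<^sub>R h - (r\<^sup>2 * (y \<bullet> h)) *\<^sub>R y, - r\<^sup>2 * (y \<bullet> h)))"
    unfolding r_def by (rule frechet_derivative_at[OF has_derivative_stereo_inv, symmetric])
  have yy: "r * (y \<bullet> y) = 2 - r"
    using conf_factor_norm_sq[of y] by (simp add: r_def power2_norm_eq_inner)
  have "(r *\<^sub>R h - (r\<^sup>2 * (y \<bullet> h)) *\<^sub>R y, - r\<^sup>2 * (y \<bullet> h)) \<bullet> (r *\<^sub>R k - (r\<^sup>2 * (y \<bullet> k)) *\<^sub>R y, - r\<^sup>2 * (y \<bullet> k))
     = r\<^sup>2 * (h \<bullet> k)" for h k
  proof -
    have "(r *\<^sub>R h - (r\<^sup>2 * (y \<bullet> h)) *\<^sub>R y, - r\<^sup>2 * (y \<bullet> h)) \<bullet> (r *\<^sub>R k - (r\<^sup>2 * (y \<bullet> k)) *\<^sub>R y, - r\<^sup>2 * (y \<bullet> k))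
      = r\<^sup>2 * (h \<bullet> k) + r^3 * (y \<bullet> h) * (y \<bullet> k) * (r * (y \<bullet> y) - 2 + r)"
      by (simp add: inner_diff_left inner_diff_right inner_commute[of h y] power2_eq_square power3_eq_cube algebra_simps)
    then show ?thesis by (simp add: yy)
  qed
  then have "induced_metric stereo_inv y = mat (r\<^sup>2)"
    by (simp add: induced_metric_def fd mat_def inner_axis_axis vec_eq_iff)
  then have "det (induced_metric stereo_inv y) = (r\<^sup>2) ^ CARD('n)"
    by (simp add: det_diagonal mat_def)
  also have "\<dots> = (r ^ CARD('n))\<^sup>2" by (simp only: power_mult[symmetric] mult.commute)
  finally show ?thesis using conf_factor_pos[of y] by (simp add: r_def)
qed

text \<open>
  A linear isometry from \<open>real ^ 'n\<close> onto the tangent space of the sphere at \<open>stereo_inv x\<close>.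
\<close>

definition tangent_iso :: "real^'n \<Rightarrow> real^'n \<Rightarrow> (real^'n) \<times> real" where
  "tangent_iso x n = (n - (conf_factor x * (n \<bullet> x)) *\<^sub>R x, - (conf_factor x * (n \<bullet> x)))"

text \<open>
  The inverse stereographic projection from the point \<open>z = stereo_inv x\<close> itself, precomposed with an isometry:
  the origin is sent to \<open>- z\<close>, and \<open>z\<close> is the limit at infinity.
\<close>

definition antipodal_param :: "real^'n \<Rightarrow> real^'n \<Rightarrow> (real^'n) \<times> real" where
  "antipodal_param x n = stereo_inv x + conf_factor n *\<^sub>R (tangent_iso x n - stereo_inv x)"

lemma norm_tangent_iso_sq: "(norm (tangent_iso x n))\<^sup>2 = (norm n)\<^sup>2"
proof -
  define r where "r = conf_factor x"
  have xx: "r * (x \<bullet> x) = 2 - r"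
    using conf_factor_norm_sq[of x] by (simp add: r_def power2_norm_eq_inner)
  have "tangent_iso x n \<bullet> tangent_iso x n = n \<bullet> n + r * (n \<bullet> x) * (n \<bullet> x) * (r * (x \<bullet> x) - 2 + r)"
    by (simp add: tangent_iso_def r_def[symmetric] inner_diff_left inner_diff_right inner_commute[of x n]
        power2_eq_square algebra_simps)
  then show ?thesis by (simp add: xx power2_norm_eq_inner)
qed

lemma tangent_iso_orthogonal: "tangent_iso x n \<bullet> stereo_inv x = 0"
proof -
  define r where "r = conf_factor x"
  have xx: "r * (x \<bullet> x) = 2 - r"
    using conf_factor_norm_sq[of x] by (simp add: r_def power2_norm_eq_inner)
  have "tangent_iso x n \<bullet> stereo_inv x = r * (n \<bullet> x) * (2 - r - r * (x \<bullet> x))"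
    by (simp add: tangent_iso_def stereo_inv_eq r_def[symmetric] inner_diff_left inner_diff_right
        algebra_simps)
  then show ?thesis by (simp add: xx)
qed

lemma norm_tangent_iso_diff_sq: "(norm (tangent_iso x n - stereo_inv x))\<^sup>2 = 1 + (norm n)\<^sup>2"
  using dot_norm_neg[of "tangent_iso x n" "stereo_inv x"]
  by (simp add: tangent_iso_orthogonal norm_tangent_iso_sq norm_stereo_inv)

lemma norm_antipodal_param_diff:
  "norm (antipodal_param x n - stereo_inv x) = 2 / sqrt (1 + (norm n)\<^sup>2)"
proof -
  have "norm (tangent_iso x n - stereo_inv x) = sqrt (1 + (norm n)\<^sup>2)"
    by (rule real_sqrt_unique[symmetric]) (simp_all add: norm_tangent_iso_diff_sq)
  moreover have "antipodal_param x n - stereo_inv x = conf_factor n *\<^sub>R (tangent_iso x n - stereo_inv x)"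
    by (simp add: antipodal_param_def)
  ultimately have "norm (antipodal_param x n - stereo_inv x) = conf_factor n * sqrt (1 + (norm n)\<^sup>2)"
    using conf_factor_pos[of n] by simp
  also have "\<dots> = 2 * (sqrt (1 + (norm n)\<^sup>2) / (1 + (norm n)\<^sup>2))"
    by (simp add: conf_factor_def)
  also have "sqrt (1 + (norm n)\<^sup>2) / (1 + (norm n)\<^sup>2) = 1 / sqrt (1 + (norm n)\<^sup>2)"
    by (subst sqrt_divide_self_eq) (auto simp: add_nonneg_nonneg inverse_eq_divide)
  also have "2 * (1 / sqrt (1 + (norm n)\<^sup>2)) = 2 / sqrt (1 + (norm n)\<^sup>2)" by simp
  finally show ?thesis .
qed

lemma norm_antipodal_param: "norm (antipodal_param x n) = 1"
proof (rule norm_eq_1I)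
  define r where "r = conf_factor n"
  let ?z = "stereo_inv x"
  define w where "w = tangent_iso x n - ?z"
  have "(norm (antipodal_param x n))\<^sup>2 = (norm ?z)\<^sup>2 + 2 * r * (?z \<bullet> w) + r * (r * (norm w)\<^sup>2)"
    unfolding antipodal_param_def r_def[symmetric] w_def[symmetric] power2_norm_eq_inner
    by (simp add: inner_add_left inner_add_right inner_commute[of w ?z] distrib_left)
  also have "?z \<bullet> w = - 1"
    using tangent_iso_orthogonal[of x n] norm_stereo_inv[of x]
    by (simp add: w_def inner_diff_right inner_commute[of ?z "tangent_iso x n"] flip: power2_norm_eq_inner)
  also have "r * (norm w)\<^sup>2 = r * (norm n)\<^sup>2 + r"
    by (simp add: w_def norm_tangent_iso_diff_sq algebra_simps)
  also have "\<dots> = 2" by (simp add: r_def conf_factor_norm_sq)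
  finally show "(norm (antipodal_param x n))\<^sup>2 = 1" by (simp add: norm_stereo_inv)
qed

text \<open>
  The tangential displacement from \<open>z\<close> is odd in \<open>n\<close> and cancels.
\<close>

lemma antipodal_param_reflect:
  fixes x n :: "real^'n"
  shows "antipodal_param x n + antipodal_param x (- n) - 2 *\<^sub>R stereo_inv x = - (2 * conf_factor n) *\<^sub>R stereo_inv x"
proof -
  have "tangent_iso x (- n) = - tangent_iso x n" "conf_factor (- n) = conf_factor n"
    by (simp_all add: tangent_iso_def conf_factor_def)
  moreover have "(2 * c) *\<^sub>R v = c *\<^sub>R v + c *\<^sub>R v" for c and v :: "(real^'n) \<times> real"
    by (simp flip: scaleR_add_left)
  ultimately show ?thesis
    by (simp add: antipodal_param_def scaleR_2 scaleR_diff_right)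
qed

lemma continuous_antipodal_param: "continuous_on UNIV (antipodal_param x)"
  unfolding antipodal_param_def[abs_def] tangent_iso_def[abs_def] conf_factor_def
  by (intro continuous_intros) (auto simp: add_nonneg_eq_0_iff)

lemma one_plus_norm_sq_inversion:
  fixes x m :: "'a::real_inner"
  assumes "m \<noteq> 0"
  defines "a \<equiv> 1 + (norm x)\<^sup>2"
  shows "1 + (norm (x + inversion a m))\<^sup>2 = a * (1 + (norm (x + m))\<^sup>2) / (norm m)\<^sup>2"
proof -
  define d where "d = m \<bullet> m"
  have d: "d \<noteq> 0" using assms by (simp add: d_def)
  have "1 + (norm (x + inversion a m))\<^sup>2 = a + 2 * (a / d) * (x \<bullet> m) + (a / d) * (a / d * d)"
  proof -
    have "1 + (norm (x + c *\<^sub>R m))\<^sup>2 = a + 2 * c * (x \<bullet> m) + c * (c * d)" for c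
      by (simp add: power2_norm_eq_inner inner_add_left inner_add_right inner_commute[of m x] a_def d_def algebra_simps)
    then show ?thesis by (simp only: inversion_def power2_norm_eq_inner d_def)
  qed
  also have "\<dots> = a * (a + 2 * (x \<bullet> m) + d) / d"
    using d by (simp add: add_divide_distrib distrib_left)
  also have "a + 2 * (x \<bullet> m) + d = 1 + (norm (x + m))\<^sup>2"
    by (simp add: power2_norm_eq_inner inner_add_left inner_add_right inner_commute[of m x] a_def d_def)
  finally show ?thesis by (simp add: d_def power2_norm_eq_inner)
qed

text \<open>
  Two stereographic projections, from different points of the sphere, differ by an inversion and isometries. The
  isometries have been absorbed into \<open>antipodal_param\<close>.
\<close>

lemma stereo_inv_inversion:
  fixes x m :: "real^'n"
  assumes "m \<noteq> 0"
  shows "stereo_inv (x + inversion (1 + (norm x)\<^sup>2) m) = antipodal_param x (x + m)"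
proof -
  define a where "a = 1 + (norm x)\<^sup>2"
  define n where "n = x + m"
  define d where "d = (norm m)\<^sup>2"
  define q where "q = 1 + (norm n)\<^sup>2"
  have a: "a > 0" and q: "q > 0" by (simp_all add: a_def q_def add_pos_nonneg)
  have d: "d \<noteq> 0" using assms by (simp add: d_def)
  have dq: "d = q - 2 * (n \<bullet> x) + a - 2"
    by (simp add: d_def q_def n_def a_def power2_norm_eq_inner inner_add_left inner_add_right inner_commute[of m x])
  have cf: "conf_factor (x + inversion a m) = 2 * d / (a * q)"
    unfolding conf_factor_def using one_plus_norm_sq_inversion[OF assms, of x]
    by (simp add: a_def d_def q_def n_def)
  have cx: "conf_factor x = 2 / a" and cn: "conf_factor n = 2 / q"
    by (simp_all add: conf_factor_def a_def q_def)
  have "(2 * d / (a * q)) *\<^sub>R (x + (a / d) *\<^sub>R m) = (2 * d / (a * q)) *\<^sub>R x + (2 / q) *\<^sub>R (n - x)"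
    using a q d by (simp add: n_def scaleR_add_right)
  also have "\<dots> = (2 / a) *\<^sub>R x + (2 / q) *\<^sub>R (n - (2 / a * (n \<bullet> x)) *\<^sub>R x - (2 / a) *\<^sub>R x)"
  proof -
    have "2 * d / (a * q) = 2 / q + (2 / a + 2 / q * (- (2 / a * (n \<bullet> x)) - 2 / a))"
      using a q unfolding dq by (simp add: divide_simps)
    moreover have "(\<beta> + (\<gamma> + \<beta> * (- \<delta> - \<gamma>))) *\<^sub>R x + \<beta> *\<^sub>R (n - x) = \<gamma> *\<^sub>R x + \<beta> *\<^sub>R (n - \<delta> *\<^sub>R x - \<gamma> *\<^sub>R x)"
      for \<beta> \<gamma> \<delta> :: real
      by (simp add: algebra_simps)
    ultimately show ?thesis by (simp only:)
  qed
  finally have 1: "(2 * d / (a * q)) *\<^sub>R (x + (a / d) *\<^sub>R m) =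
      (2 / a) *\<^sub>R x + (2 / q) *\<^sub>R (n - (2 / a * (n \<bullet> x)) *\<^sub>R x - (2 / a) *\<^sub>R x)" .
  have 2: "2 * d / (a * q) - 1 = 2 / a - 1 + 2 / q * (- (2 / a * (n \<bullet> x)) - (2 / a - 1))"
    using a q unfolding dq by (simp add: divide_simps) (simp add: algebra_simps)
  have "stereo_inv (x + inversion a m) = antipodal_param x n"
    unfolding antipodal_param_def stereo_inv_eq tangent_iso_def cf cx cn
    by (simp only: inversion_def d_def[symmetric] scaleR_Pair diff_Pair add_Pair real_scaleR_def 1 2)
  then show ?thesis by (simp add: a_def n_def)
qed

lemma continuous_stereo_inv: "continuous_on UNIV stereo_inv"
  unfolding stereo_inv_eq[abs_def] conf_factor_def
  by (intro continuous_intros) (auto simp: add_nonneg_eq_0_iff)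

lemma has_bochner_integral_lborel_inversion_at:
  fixes f :: "real^'n \<Rightarrow> real"
  assumes [measurable]: "f \<in> borel_measurable borel" and "a \<noteq> 0"
  shows "has_bochner_integral lborel f I \<longleftrightarrow>
    has_bochner_integral lborel (\<lambda>m. (\<bar>a\<bar> / (norm m)\<^sup>2) ^ CARD('n) * f (x + inversion a m)) I"
  by (subst has_bochner_integral_translate[of f I x], simp,
      subst has_bochner_integral_inversion[of _ a]) (use assms(2) in auto)

text \<open>
  The surface integral in the chart \<open>antipodal_param x\<close>. The volume density has the same form as in the
  original chart, since the charts are related by an isometry of the sphere.
\<close>

lemma has_bochner_integral_sphere_volume:
  fixes f :: "(real^'n) \<times> real \<Rightarrow> real"
  assumes f: "f \<in> borel_measurable (restrict_space borel unit_sphere)"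
  shows "has_bochner_integral sphere_volume f I \<longleftrightarrow>
    has_bochner_integral lborel (\<lambda>n. conf_factor n ^ CARD('n) * f (antipodal_param x n)) I"
proof -
  define a where "a = 1 + (norm x)\<^sup>2"
  have a: "a > 0" by (simp add: a_def add_pos_nonneg)
  have \<phi>: "stereo_inv \<in> borel \<rightarrow>\<^sub>M restrict_space borel (unit_sphere :: ((real^'n) \<times> real) set)"
    by (rule measurable_restrict_space2)
       (auto simp: norm_stereo_inv intro: borel_measurable_continuous_onI continuous_stereo_inv)
  have \<zeta>: "antipodal_param x \<in> borel \<rightarrow>\<^sub>M restrict_space borel (unit_sphere :: ((real^'n) \<times> real) set)"
    by (rule measurable_restrict_space2)
       (auto simp: norm_antipodal_param intro: borel_measurable_continuous_onI continuous_antipodal_param)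
  have [measurable]: "(\<lambda>y. f (stereo_inv y)) \<in> borel_measurable borel"
    "(\<lambda>y. f (antipodal_param x y)) \<in> borel_measurable borel"
    using measurable_compose[OF \<phi> f] measurable_compose[OF \<zeta> f] by auto
  have [measurable]: "(conf_factor :: real^'n \<Rightarrow> real) \<in> borel_measurable borel"
    unfolding conf_factor_def[abs_def] by measurable
  have "has_bochner_integral sphere_volume f I \<longleftrightarrow>
     has_bochner_integral (density lborel (\<lambda>y::real^'n. ennreal (conf_factor y ^ CARD('n)))) (\<lambda>y. f (stereo_inv y)) I"
    unfolding sphere_volume_def sqrt_det_induced_metric
    by (rule has_bochner_integral_distr_eq) (use \<phi> f in auto)
  also have "\<dots> \<longleftrightarrow> has_bochner_integral lborel (\<lambda>y. conf_factor y ^ CARD('n) * f (stereo_inv y)) I"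
  proof -
    have 1: "(\<lambda>y::real^'n. conf_factor y ^ CARD('n)) \<in> borel_measurable lborel"
      and 3: "(\<lambda>y. f (stereo_inv y)) \<in> borel_measurable lborel"
      by measurable
    have 2: "AE y::real^'n in lborel. 0 \<le> conf_factor y ^ CARD('n)"
      by (rule AE_I2, rule zero_le_power, rule less_imp_le, rule conf_factor_pos)
    from integrable_density[OF 3 1 2] integral_density[OF 3 1 2]
    show ?thesis unfolding has_bochner_integral_iff real_scaleR_def by (simp only:)
  qed
  also have "\<dots> \<longleftrightarrow> has_bochner_integral lborel (\<lambda>m. (\<bar>a\<bar> / (norm m)\<^sup>2) ^ CARD('n) *
      (conf_factor (x + inversion a m) ^ CARD('n) * f (stereo_inv (x + inversion a m)))) I"
    by (rule has_bochner_integral_lborel_inversion_at) (measurable, use a in simp)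
  also have "\<dots> \<longleftrightarrow> has_bochner_integral lborel (\<lambda>m. conf_factor (x + m) ^ CARD('n) * f (antipodal_param x (x + m))) I"
  proof (rule has_bochner_integral_cong_AE)
    show "AE m in lborel. (\<bar>a\<bar> / (norm m)\<^sup>2) ^ CARD('n) *
      (conf_factor (x + inversion a m) ^ CARD('n) * f (stereo_inv (x + inversion a m))) =
      conf_factor (x + m) ^ CARD('n) * f (antipodal_param x (x + m))"
      using AE_lborel_singleton[of "0 :: real^'n"]
    proof eventually_elim
      case (elim m)
      have "\<bar>a\<bar> / (norm m)\<^sup>2 * conf_factor (x + inversion a m) = conf_factor (x + m)"
        using one_plus_norm_sq_inversion[OF elim, of x] a elim
        by (simp add: conf_factor_def a_def[symmetric])
      then show ?case
        by (simp add: stereo_inv_inversion[OF elim, of x, folded a_def] power_mult_distrib[symmetric] mult.assoc[symmetric])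
    qed
  qed (measurable)
  also have "\<dots> \<longleftrightarrow> has_bochner_integral lborel (\<lambda>n. conf_factor n ^ CARD('n) * f (antipodal_param x n)) I"
    by (rule has_bochner_integral_translate[symmetric]) measurable
  finally show ?thesis .
qed

section \<open>Second order expansion of smooth functions\<close>

lemma smooth_fun_on_imp_continuous_on:
  assumes "smooth_fun_on S u"
  shows "continuous_on S u"
proof (rule continuous_on_eq_continuous_within[THEN iffD2], rule ballI)
  fix z assume z: "z \<in> S"
  then obtain U F where U: "open U" "z \<in> U" "\<forall>k. Ck_on k U F" "\<forall>y\<in>U \<inter> S. F y = u y"
    using assms unfolding smooth_fun_on_def by blast
  have "continuous_on U F" using U(3)[rule_format, of 0] by simp
  then have "continuous (at z within S) F"
    using U(1,2) continuous_on_eq_continuous_at continuous_at_imp_continuous_at_within by blast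
  then show "continuous (at z within S) u"
  proof (rule continuous_transform_within_openin[where S="U \<inter> S"])
    show "openin (top_of_set S) (U \<inter> S)"
      using U(1) by (metis inf_commute openin_open_Int)
  qed (use U z in auto)
qed

text \<open>
  Differentiability of \<open>F\<close> near \<open>z\<close> and of its partial derivatives at \<open>z\<close> already gives the bound: the
  derivative is Lipschitz at \<open>z\<close>, and the mean value theorem applies on segments.
\<close>

lemma Ck_on_second_order:
  fixes F :: "'a::euclidean_space \<Rightarrow> real"
  assumes U: "open U" "z \<in> U" and F: "Ck_on 2 U F"
  obtains l C \<delta> where "bounded_linear l" "C \<ge> 0" "\<delta> > 0" "ball z \<delta> \<subseteq> U"
    "\<And>y. y \<in> ball z \<delta> \<Longrightarrow> \<bar>F y - F z - l (y - z)\<bar> \<le> C * (norm (y - z))\<^sup>2"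
proof -
  let ?D = "\<lambda>y. frechet_derivative F (at y)"
  have d1: "(F has_derivative ?D y) (at y)" if "y \<in> U" for y
    using F that by (auto simp: numeral_2_eq_2 frechet_derivative_works)
  have d2: "(\<lambda>y. ?D y b) differentiable (at z)" for b
    using F U(2) by (auto simp: numeral_2_eq_2)
  have "\<exists>C \<delta>. \<delta> > 0 \<and> C \<ge> 0 \<and> (\<forall>y. norm (y - z) < \<delta> \<longrightarrow> \<bar>?D y b - ?D z b\<bar> \<le> C * norm (y - z))" for b
  proof -
    obtain G where G: "((\<lambda>y. ?D y b) has_derivative G) (at z)"
      using d2[of b] by (auto simp: differentiable_def)
    then have bl: "bounded_linear G" by (rule has_derivative_bounded_linear)
    obtain \<delta> where \<delta>: "\<delta> > 0" "\<And>y. norm (y - z) < \<delta> \<Longrightarrow> \<bar>?D y b - ?D z b - G (y - z)\<bar> \<le> 1 * norm (y - z)"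
      using G[unfolded has_derivative_at_alt, THEN conjunct2, rule_format, of 1] by auto
    have "\<bar>?D y b - ?D z b\<bar> \<le> (1 + onorm G) * norm (y - z)" if "norm (y - z) < \<delta>" for y
      using \<delta>(2)[OF that] onorm[OF bl, of "y - z"] by (simp add: algebra_simps)
    moreover have "1 + onorm G \<ge> 0" using onorm_pos_le[OF bl] by simp
    ultimately show ?thesis using \<delta>(1) by blast
  qed
  then obtain C \<delta> where C: "\<And>b. \<delta> b > 0" "\<And>b. C b \<ge> 0"
    "\<And>b y. norm (y - z) < \<delta> b \<Longrightarrow> \<bar>?D y b - ?D z b\<bar> \<le> C b * norm (y - z)"
    by metis
  obtain r where r: "r > 0" "ball z r \<subseteq> U" using U openE by blast
  define d where "d = min r (Min (\<delta> ` Basis))"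
  define K where "K = (\<Sum>b\<in>(Basis::'a set). C b)"
  have d: "d > 0" "d \<le> r" "\<And>b. b \<in> Basis \<Longrightarrow> d \<le> \<delta> b"
    using r C(1) by (auto simp: d_def min_le_iff_disj)
  have K: "K \<ge> 0" by (simp add: K_def C sum_nonneg)
  have "\<bar>F y - F z - ?D z (y - z)\<bar> \<le> K * (norm (y - z))\<^sup>2" if y: "y \<in> ball z d" for y
  proof -
    define h where "h = y - z"
    have nh: "norm h < d" using y by (simp add: h_def dist_norm norm_minus_commute)
    have in_U: "z + t *\<^sub>R h \<in> U" and small: "norm (t *\<^sub>R h) < d" "norm (t *\<^sub>R h) \<le> norm h" if "0 \<le> t" "t \<le> 1" for t
    proof -
      show *: "norm (t *\<^sub>R h) \<le> norm h" using that by (simp add: mult_left_le_one_le)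
      then show "norm (t *\<^sub>R h) < d" using nh by simp
      then have "z + t *\<^sub>R h \<in> ball z r" using d by (simp add: dist_norm)
      then show "z + t *\<^sub>R h \<in> U" using r by auto
    qed
    have "\<exists>t\<in>{0<..<1}. (F (z + 1 *\<^sub>R h) - 1 * ?D z h) - (F (z + 0 *\<^sub>R h) - 0 * ?D z h) =
        (\<lambda>\<tau>. ?D (z + t *\<^sub>R h) (\<tau> *\<^sub>R h) - \<tau> * ?D z h) (1 - 0)"
    proof (rule mvt_simple[where f = "\<lambda>t. F (z + t *\<^sub>R h) - t * ?D z h"])
      fix t :: real assume t: "0 \<le> t" "t \<le> 1"
      have "((\<lambda>t. F (z + t *\<^sub>R h)) has_derivative (\<lambda>\<tau>. ?D (z + t *\<^sub>R h) (\<tau> *\<^sub>R h))) (at t)"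
        by (rule has_derivative_compose[where g=F and f="\<lambda>t. z + t *\<^sub>R h" and f'="\<lambda>\<tau>. \<tau> *\<^sub>R h"])
           (auto intro!: derivative_eq_intros d1 in_U t)
      then have "((\<lambda>t. F (z + t *\<^sub>R h) - t * ?D z h) has_derivative
          (\<lambda>\<tau>. ?D (z + t *\<^sub>R h) (\<tau> *\<^sub>R h) - \<tau> * ?D z h)) (at t)"
        by (auto intro!: derivative_eq_intros)
      then show "((\<lambda>t. F (z + t *\<^sub>R h) - t * ?D z h) has_derivative
          (\<lambda>\<tau>. ?D (z + t *\<^sub>R h) (\<tau> *\<^sub>R h) - \<tau> * ?D z h)) (at t within {0..1})"
        by (rule has_derivative_at_withinI)
    qed simp
    then obtain t where t: "0 < t" "t < 1" and eq: "F y - F z - ?D z h = ?D (z + t *\<^sub>R h) h - ?D z h"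
      by (auto simp: h_def)
    have lin: "linear (?D (z + t *\<^sub>R h))" "linear (?D z)"
      using d1[OF in_U[of t]] d1[OF U(2)] t by (auto intro: has_derivative_linear)
    have expand: "L h = (\<Sum>b\<in>Basis. (h \<bullet> b) * L b)" if "linear L" for L :: "'a \<Rightarrow> real"
      by (subst euclidean_representation[of h, symmetric], subst linear_sum[OF that])
         (simp add: linear_scale[OF that])
    have "\<bar>?D (z + t *\<^sub>R h) h - ?D z h\<bar> = \<bar>\<Sum>b\<in>Basis. (h \<bullet> b) * (?D (z + t *\<^sub>R h) b - ?D z b)\<bar>"
      by (simp add: expand[OF lin(1)] expand[OF lin(2)] sum_subtractf right_diff_distrib)
    also have "\<dots> \<le> (\<Sum>b\<in>Basis. \<bar>(h \<bullet> b) * (?D (z + t *\<^sub>R h) b - ?D z b)\<bar>)" by (rule sum_abs)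
    also have "\<dots> \<le> (\<Sum>b\<in>(Basis::'a set). norm h * (C b * norm h))"
    proof (rule sum_mono)
      fix b :: 'a assume b: "b \<in> Basis"
      have "\<bar>?D (z + t *\<^sub>R h) b - ?D z b\<bar> \<le> C b * norm (t *\<^sub>R h)"
        using C(3)[of "z + t *\<^sub>R h" b] small(1)[of t] t d(3)[OF b] by simp
      also have "\<dots> \<le> C b * norm h" using small(2)[of t] t C(2) by (intro mult_left_mono) auto
      finally show "\<bar>(h \<bullet> b) * (?D (z + t *\<^sub>R h) b - ?D z b)\<bar> \<le> norm h * (C b * norm h)"
        unfolding abs_mult by (intro mult_mono Basis_le_norm b) auto
    qed
    also have "\<dots> = K * (norm h)\<^sup>2"
      by (simp add: K_def sum_distrib_left sum_distrib_right power2_eq_square mult_ac)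
    finally show ?thesis using eq by (simp add: h_def)
  qed
  moreover have "bounded_linear (?D z)" by (rule has_derivative_bounded_linear[OF d1[OF U(2)]])
  moreover have "ball z d \<subseteq> U" using r d by auto
  ultimately show ?thesis using that K d(1) by blast
qed

lemma smooth_fun_on_second_order:
  fixes u :: "'a::euclidean_space \<Rightarrow> real"
  assumes "compact S" and u: "smooth_fun_on S u" and z: "z \<in> S"
  obtains l C where "bounded_linear l" "C \<ge> 0"
    "\<And>y. y \<in> S \<Longrightarrow> \<bar>u y - u z - l (y - z)\<bar> \<le> C * (norm (y - z))\<^sup>2"
proof -
  obtain U F where U: "open U" "z \<in> U" "\<forall>k. Ck_on k U F" "\<forall>y\<in>U \<inter> S. F y = u y"
    using u z unfolding smooth_fun_on_def by blast
  obtain l C \<delta> where l: "bounded_linear l" and C: "C \<ge> 0" "\<delta> > 0" "ball z \<delta> \<subseteq> U"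
    "\<And>y. y \<in> ball z \<delta> \<Longrightarrow> \<bar>F y - F z - l (y - z)\<bar> \<le> C * (norm (y - z))\<^sup>2"
    using Ck_on_second_order[OF U(1,2) U(3)[rule_format, of 2]] by blast
  have "continuous_on S (\<lambda>y. u y - u z - l (y - z))"
    by (intro continuous_intros smooth_fun_on_imp_continuous_on[OF u] bounded_linear.continuous_on[OF l])
  then have "compact ((\<lambda>y. u y - u z - l (y - z)) ` S)"
    using assms(1) by (rule compact_continuous_image)
  then have "bounded ((\<lambda>y. u y - u z - l (y - z)) ` S)" by (rule compact_imp_bounded)
  then obtain B where B: "\<And>y. y \<in> S \<Longrightarrow> \<bar>u y - u z - l (y - z)\<bar> \<le> B"
    by (auto simp: bounded_iff)
  have "B \<ge> 0" using B[OF z] by linarith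
  \<comment> \<open>Away from \<open>z\<close> the bound \<open>B\<close> is absorbed by \<open>|y - z| \<ge> \<delta>\<close>.\<close>
  define K where "K = C + B / \<delta>\<^sup>2"
  have "\<bar>u y - u z - l (y - z)\<bar> \<le> K * (norm (y - z))\<^sup>2" if y: "y \<in> S" for y
  proof (cases "y \<in> ball z \<delta>")
    case True
    then have "\<bar>u y - u z - l (y - z)\<bar> \<le> C * (norm (y - z))\<^sup>2"
      using C(3,4) U(2,4) y z by (metis IntI in_mono)
    also have "\<dots> \<le> K * (norm (y - z))\<^sup>2"
      using \<open>B \<ge> 0\<close> by (intro mult_right_mono) (auto simp: K_def)
    finally show ?thesis .
  next
    case False
    then have "\<delta> \<le> norm (y - z)" by (simp add: dist_norm norm_minus_commute)
    then have "\<delta>\<^sup>2 \<le> (norm (y - z))\<^sup>2" using C(2) by (intro power_mono) auto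
    then have "B \<le> B / \<delta>\<^sup>2 * (norm (y - z))\<^sup>2"
      using \<open>B \<ge> 0\<close> C(2) by (simp add: field_simps mult_left_mono)
    also have "\<dots> \<le> K * (norm (y - z))\<^sup>2" using C(1) by (intro mult_right_mono) (auto simp: K_def)
    finally show ?thesis using B[OF y] by linarith
  qed
  moreover have "K \<ge> 0" using C \<open>B \<ge> 0\<close> by (simp add: K_def)
  ultimately show ?thesis using that l by blast
qed

section \<open>The integrand in the chart at the antipode\<close>

text \<open>
  The function called \<open>b\<close> above. In the chart \<open>antipodal_param x\<close> it is what is left of the kernel after
  multiplication by the volume density, up to the factor \<open>4 powr (- s)\<close>.
\<close>

definition bracket_powr :: "real \<Rightarrow> 'a::real_normed_vector \<Rightarrow> real" where
  "bracket_powr p y = (1 + (norm y)\<^sup>2) powr (- p / 2)"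

lemma continuous_bracket_powr: "continuous_on UNIV (bracket_powr p)"
  unfolding bracket_powr_def[abs_def]
  by (intro continuous_intros) (auto simp: add_nonneg_eq_0_iff)

lemma bracket_powr_pos: "bracket_powr p y > 0"
  using one_plus_norm_sq_pos[of y] by (simp add: bracket_powr_def)

lemma set_integrable_cball_continuous:
  fixes f :: "'a::euclidean_space \<Rightarrow> real"
  assumes "continuous_on UNIV f"
  shows "set_integrable lborel (cball c R) f"
  unfolding set_integrable_def
  by (rule borel_integrable_compact) (auto intro: continuous_on_subset[OF assms])

lemma one_plus_sq_powr_lipschitz:
  fixes p \<rho> r r' :: real
  assumes p: "p > 0" and \<rho>: "\<rho> > 0" "\<rho> \<le> r" "\<rho> \<le> r'"
  shows "\<bar>(1 + r\<^sup>2) powr (- p / 2) - (1 + r'\<^sup>2) powr (- p / 2)\<bar> \<le> p * \<rho> powr (- p - 1) * \<bar>r - r'\<bar>"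
proof -
  let ?\<phi> = "\<lambda>r. (1 + r\<^sup>2) powr (- p / 2)"
  let ?\<phi>' = "\<lambda>r. - p * r * (1 + r\<^sup>2) powr (- p / 2 - 1)"
  have "norm (?\<phi> r - ?\<phi> r') \<le> (p * \<rho> powr (- p - 1)) * norm (r - r')"
  proof (rule field_differentiable_bound[where S="{\<rho>..}" and f'="?\<phi>'"])
    fix t assume "t \<in> {\<rho>..}"
    then have t: "t > 0" "\<rho> \<le> t" using \<rho> by auto
    have pos: "1 + t\<^sup>2 > 0" by (simp add: add_pos_nonneg)
    show "(?\<phi> has_field_derivative ?\<phi>' t) (at t within {\<rho>..})"
      using pos by (auto intro!: derivative_eq_intros)
    have "norm (?\<phi>' t) = p * t * (1 + t\<^sup>2) powr (- p / 2 - 1)"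
      using p t by (simp add: abs_mult)
    also have "\<dots> \<le> p * t * (t\<^sup>2) powr (- p / 2 - 1)"
      using p t by (intro mult_left_mono powr_mono2') auto
    also have "(t\<^sup>2) powr (- p / 2 - 1) = t powr (- p - 2)"
      using t by (simp add: powr_powr flip: powr_numeral)
    also have "p * t * t powr (- p - 2) = p * t powr (1 + (- p - 2))"
      using t by (simp only: mult.assoc powr_mult_base less_imp_le)
    also have "p * t powr (1 + (- p - 2)) = p * t powr (- p - 1)"
      by (rule arg_cong[where f="\<lambda>e. p * t powr e"]) simp
    also have "\<dots> \<le> p * \<rho> powr (- p - 1)"
      using p t \<rho> by (intro mult_left_mono powr_mono2') auto
    finally show "norm (?\<phi>' t) \<le> p * \<rho> powr (- p - 1)" .
  qed (use \<rho> in auto)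
  then show ?thesis by simp
qed

lemma half_powr: 
  fixes R q :: real
  assumes "R > 0" shows "(R / 2) powr (- q) = 2 powr q * R powr (- q)"
  using assms by (simp add: powr_divide powr_minus divide_simps)

text \<open>
  On the shell \<open>bracket_powr p\<close> is compared with its value on the sphere of radius \<open>R\<close>.
\<close>

lemma bracket_powr_shifted_ball:
  fixes x :: "'a::euclidean_space"
  assumes p: "p > 0" "p > real DIM('a) - 2"
  shows "((\<lambda>R. (LINT y:cball x R|lborel. bracket_powr p y) - (LINT y:cball (0::'a) R|lborel. bracket_powr p y)) \<longlongrightarrow> 0) at_top"
proof (rule shifted_ball_integral_limit[where f = "bracket_powr p" and x = x and \<alpha> = "p + 1" and k = "\<lambda>R. (1 + R\<^sup>2) powr (- p / 2)"
      and C = "p * 2 powr (p + 1) * norm x"])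
  fix R and y :: 'a
  assume R: "2 * norm x + 1 \<le> R" "R - norm x \<le> norm y" "norm y \<le> R + norm x"
  have R0: "R > 0" "R / 2 \<le> norm y" "R / 2 \<le> R" using R norm_ge_zero[of x] by linarith+
  have "\<bar>bracket_powr p y - (1 + R\<^sup>2) powr (- p / 2)\<bar> \<le> p * (R / 2) powr (- p - 1) * \<bar>norm y - R\<bar>"
    unfolding bracket_powr_def by (rule one_plus_sq_powr_lipschitz) (use p R0 in auto)
  also have "\<dots> \<le> p * (R / 2) powr (- p - 1) * norm x"
    using R p by (intro mult_left_mono) auto
  also have "(R / 2) powr (- p - 1) = 2 powr (p + 1) * R powr (- (p + 1))"
    using half_powr[OF R0(1), of "p + 1"] by simp
  finally show "\<bar>bracket_powr p y - (1 + R\<^sup>2) powr (- p / 2)\<bar> \<le> p * 2 powr (p + 1) * norm x * R powr (- (p + 1))"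
    by (simp add: mult_ac)
qed (use p in \<open>auto intro: set_integrable_cball_continuous continuous_bracket_powr\<close>)

text \<open>
  The function called \<open>W\<close> above: the integrand on the sphere, without the factor \<open>4 powr (- s)\<close>, in the chart
  \<open>antipodal_param x\<close>.
\<close>

definition chart_integrand :: "real \<Rightarrow> ((real^'n) \<times> real \<Rightarrow> real) \<Rightarrow> real^'n \<Rightarrow> real^'n \<Rightarrow> real" where
  "chart_integrand s u x n = (u (stereo_inv x) - u (antipodal_param x n)) * bracket_powr (real CARD('n) - 2 * s) n"

lemma continuous_antipodal_compose:
  assumes "continuous_on unit_sphere u"
  shows "continuous_on UNIV (\<lambda>n. u (antipodal_param x n))"
  by (rule continuous_on_compose2[OF assms continuous_antipodal_param]) (auto simp: norm_antipodal_param)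

lemma continuous_chart_integrand:
  assumes "continuous_on unit_sphere u"
  shows "continuous_on UNIV (chart_integrand s u x)"
  unfolding chart_integrand_def[abs_def]
  by (intro continuous_intros continuous_antipodal_compose assms continuous_bracket_powr)

lemma chart_integrand_estimates:
  fixes x :: "real^'n" and s :: real
  assumes u: "smooth_fun_on unit_sphere u"
  defines "p \<equiv> real CARD('n) - 2 * s"
  obtains C where "C \<ge> 0"
    "\<And>n. \<bar>chart_integrand s u x n\<bar> \<le> C * bracket_powr (p + 1) n"
    "\<And>n. \<bar>chart_integrand s u x n + chart_integrand s u x (- n)\<bar> \<le> C * bracket_powr (p + 2) n"
proof -
  define z where "z = stereo_inv x"
  have z: "z \<in> unit_sphere" "norm z = 1" by (simp_all add: z_def norm_stereo_inv)
  obtain l C where l: "bounded_linear l" and C: "C \<ge> 0"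
    "\<And>y. y \<in> unit_sphere \<Longrightarrow> \<bar>u y - u z - l (y - z)\<bar> \<le> C * (norm (y - z))\<^sup>2"
    using smooth_fun_on_second_order[OF compact_sphere u z(1)] by blast
  have on: "onorm l \<ge> 0" by (rule onorm_pos_le[OF l])
  let ?\<zeta> = "antipodal_param x"
  have \<zeta>: "?\<zeta> n \<in> unit_sphere" for n by (simp add: norm_antipodal_param)
  have d: "norm (?\<zeta> n - z) = 2 / sqrt (1 + (norm n)\<^sup>2)" for n
    unfolding z_def by (rule norm_antipodal_param_diff)
  have d2: "norm (?\<zeta> n - z) \<le> 2" for n
  proof -
    have "2 / sqrt (1 + (norm n)\<^sup>2) \<le> 2 / 1" by (rule divide_left_mono) (auto simp: add_pos_nonneg)
    then show ?thesis by (simp add: d)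
  qed
  have q: "1 + (norm n)\<^sup>2 > 0" for n :: "real^'n" by (simp add: add_pos_nonneg)
  have b1: "1 / sqrt (1 + (norm n)\<^sup>2) * bracket_powr p n = bracket_powr (p + 1) n" for n :: "real^'n"
  proof -
    have "1 / sqrt (1 + (norm n)\<^sup>2) = (1 + (norm n)\<^sup>2) powr (- 1 / 2)"
    proof -
      have "(1 + (norm n)\<^sup>2) powr (- (1 / 2)) = 1 / (1 + (norm n)\<^sup>2) powr (1 / 2)"
        by (rule powr_minus_divide)
      then show ?thesis by (simp only: powr_half_sqrt[OF less_imp_le[OF q]] minus_divide_left)
    qed
    then have "1 / sqrt (1 + (norm n)\<^sup>2) * bracket_powr p n = (1 + (norm n)\<^sup>2) powr (- 1 / 2 + - p / 2)"
      by (simp only: bracket_powr_def powr_add)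
    also have "- 1 / 2 + - p / 2 = - (p + 1) / 2" by (simp add: field_simps)
    finally show ?thesis by (simp only: bracket_powr_def)
  qed
  have b2: "1 / (1 + (norm n)\<^sup>2) * bracket_powr p n = bracket_powr (p + 2) n" for n :: "real^'n"
  proof -
    have "1 / (1 + (norm n)\<^sup>2) = (1 + (norm n)\<^sup>2) powr (- 1)"
      using q[of n] by (simp add: powr_minus_divide)
    then have "1 / (1 + (norm n)\<^sup>2) * bracket_powr p n = (1 + (norm n)\<^sup>2) powr (- 1 + - p / 2)"
      by (simp only: bracket_powr_def powr_add)
    also have "- 1 + - p / 2 = - (p + 2) / 2" by (simp add: field_simps)
    finally show ?thesis by (simp only: bracket_powr_def)
  qed
  define K where "K = 2 * onorm l + 8 * C + 4 * onorm l"
  have K: "K \<ge> 0" using on C by (simp add: K_def)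
  have "\<bar>chart_integrand s u x n\<bar> \<le> K * bracket_powr (p + 1) n" for n
  proof -
    have "\<bar>u (?\<zeta> n) - u z\<bar> \<le> \<bar>u (?\<zeta> n) - u z - l (?\<zeta> n - z)\<bar> + \<bar>l (?\<zeta> n - z)\<bar>" by linarith
    also have "\<dots> \<le> C * (norm (?\<zeta> n - z))\<^sup>2 + onorm l * norm (?\<zeta> n - z)"
      using C(2)[OF \<zeta>] onorm[OF l, of "?\<zeta> n - z"] by (intro add_mono) auto
    also have "\<dots> \<le> C * (2 * norm (?\<zeta> n - z)) + onorm l * norm (?\<zeta> n - z)"
      using d2[of n] C(1) by (intro add_mono order_refl mult_left_mono) (auto simp: power2_eq_square mult_right_mono)
    also have "\<dots> = (2 * onorm l + 4 * C) * (1 / sqrt (1 + (norm n)\<^sup>2))"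
      by (simp add: d algebra_simps)
    also have "\<dots> \<le> K * (1 / sqrt (1 + (norm n)\<^sup>2))"
      using on C q[of n] by (intro mult_right_mono) (auto simp: K_def)
    finally have "\<bar>u z - u (?\<zeta> n)\<bar> * bracket_powr p n \<le> K * (1 / sqrt (1 + (norm n)\<^sup>2)) * bracket_powr p n"
      by (intro mult_right_mono) (auto simp: less_imp_le[OF bracket_powr_pos] abs_minus_commute)
    then show ?thesis
      using bracket_powr_pos[of p n]
      by (simp only: mult.assoc b1 chart_integrand_def z_def[symmetric] p_def[symmetric] abs_mult abs_of_pos)
  qed
  moreover have "\<bar>chart_integrand s u x n + chart_integrand s u x (- n)\<bar> \<le> K * bracket_powr (p + 2) n" for n
  proof -
    let ?L = "\<lambda>n. u (?\<zeta> n) - u z - l (?\<zeta> n - z)"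
    have "l (?\<zeta> n - z) + l (?\<zeta> (- n) - z) = l ((?\<zeta> n - z) + (?\<zeta> (- n) - z))"
      by (rule linear_simps(1)[OF l, symmetric])
    also have "(?\<zeta> n - z) + (?\<zeta> (- n) - z) = ?\<zeta> n + ?\<zeta> (- n) - 2 *\<^sub>R z"
      by (simp add: scaleR_2)
    also have "\<dots> = - (2 * conf_factor n) *\<^sub>R z"
      unfolding z_def by (rule antipodal_param_reflect)
    finally have e: "l (?\<zeta> n - z) + l (?\<zeta> (- n) - z) = l (- (2 * conf_factor n) *\<^sub>R z)" .
    have l1: "\<bar>l (- (2 * conf_factor n) *\<^sub>R z)\<bar> \<le> 4 * onorm l * (1 / (1 + (norm n)\<^sup>2))"
    proof -
      have "norm (- (2 * conf_factor n) *\<^sub>R z) = 4 * (1 / (1 + (norm n)\<^sup>2))"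
        using conf_factor_pos[of n] by (simp add: z(2) conf_factor_def)
      then show ?thesis
        using onorm[OF l, of "- (2 * conf_factor n) *\<^sub>R z"] by (simp add: mult_ac)
    qed
    have "\<bar>?L n\<bar> \<le> 4 * C * (1 / (1 + (norm n)\<^sup>2))" for n
      using C(2)[OF \<zeta>[of n]] q[of n] by (simp add: d power_divide less_imp_le mult.commute)
    from this[of n] this[of "- n"] l1 e
    have "\<bar>(u z - u (?\<zeta> n)) + (u z - u (?\<zeta> (- n)))\<bar> \<le>
        4 * C * (1 / (1 + (norm n)\<^sup>2)) + 4 * C * (1 / (1 + (norm n)\<^sup>2)) + 4 * onorm l * (1 / (1 + (norm n)\<^sup>2))"
      unfolding norm_minus_cancel by linarith
    also have "\<dots> = (8 * C + 4 * onorm l) * (1 / (1 + (norm n)\<^sup>2))" by (simp add: algebra_simps)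
    also have "\<dots> \<le> K * (1 / (1 + (norm n)\<^sup>2))"
      using on q[of n] by (intro mult_right_mono) (auto simp: K_def)
    finally have *: "\<bar>(u z - u (?\<zeta> n)) + (u z - u (?\<zeta> (- n)))\<bar> * bracket_powr p n \<le> K * (1 / (1 + (norm n)\<^sup>2)) * bracket_powr p n"
      by (intro mult_right_mono) (auto simp: less_imp_le[OF bracket_powr_pos])
    have "bracket_powr p (- n) = bracket_powr p n" by (simp add: bracket_powr_def)
    then have "\<bar>chart_integrand s u x n + chart_integrand s u x (- n)\<bar> =
        \<bar>(u z - u (?\<zeta> n)) + (u z - u (?\<zeta> (- n)))\<bar> * bracket_powr p n"
      using bracket_powr_pos[of p n]
      by (simp add: chart_integrand_def z_def[symmetric] p_def[symmetric] distrib_right[symmetric] abs_mult)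
    with * show ?thesis by (simp only: mult.assoc b2)
  qed
  ultimately show ?thesis using that K by blast
qed

lemma chart_integrand_ball_limits:
  fixes x :: "real^'n"
  assumes s: "0 < s" "s < 1" "2 * s < real CARD('n)" and u: "smooth_fun_on unit_sphere u"
  obtains I where
    "((\<lambda>R. LINT n:cball 0 R|lborel. chart_integrand s u x n) \<longlongrightarrow> I) at_top"
    "((\<lambda>R. LINT n:cball x R|lborel. chart_integrand s u x n) \<longlongrightarrow> I) at_top"
proof -
  let ?W = "chart_integrand s u x"
  define p where "p = real CARD('n) - 2 * s"
  have cont: "continuous_on UNIV ?W"
    by (rule continuous_chart_integrand[OF smooth_fun_on_imp_continuous_on[OF u]])
  then have [measurable]: "?W \<in> borel_measurable borel" by (rule borel_measurable_continuous_onI)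
  have int: "set_integrable lborel (cball 0 R) ?W" for R
    by (rule set_integrable_cball_continuous[OF cont])
  obtain C where C: "C \<ge> 0" "\<And>n. \<bar>?W n\<bar> \<le> C * bracket_powr (p + 1) n"
    "\<And>n. \<bar>?W n + ?W (- n)\<bar> \<le> C * bracket_powr (p + 2) n"
    using chart_integrand_estimates[OF u, where x=x and s=s] unfolding p_def by blast
  have "integrable lborel (\<lambda>n. ?W n + ?W (- n))"
  proof (rule Bochner_Integration.integrable_bound)
    have "p + 2 > DIM(real^'n)" using s by (simp add: p_def)
    from integrable_mult_right[OF integrable_bracket_powr[OF this], of C]
    show "integrable lborel (\<lambda>n::real^'n. C * bracket_powr (p + 2) n)"
      unfolding bracket_powr_def .
    show "AE n in lborel. norm (?W n + ?W (- n)) \<le> norm (C * bracket_powr (p + 2) n)"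
    proof (rule AE_I2)
      fix n :: "real^'n"
      show "norm (?W n + ?W (- n)) \<le> norm (C * bracket_powr (p + 2) n)"
        using C(3)[of n] unfolding real_norm_def by linarith
    qed
  qed measurable
  from even_part_ball_integral_tendsto[OF int _ this]
  have lim0: "((\<lambda>R. LINT n:cball 0 R|lborel. ?W n) \<longlongrightarrow> (\<integral>n. ?W n + ?W (- n) \<partial>lborel) / 2) at_top"
    by measurable
  have "((\<lambda>R. (LINT y:cball x R|lborel. ?W y) - (LINT y:cball 0 R|lborel. ?W y)) \<longlongrightarrow> 0) at_top"
  proof (rule shifted_ball_integral_limit[OF int, where \<alpha> = "p + 1" and k = "\<lambda>_. 0" and C = "C * 2 powr (p + 1)"])
    show "p + 1 > real DIM(real^'n) - 1" using s by (simp add: p_def)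
    fix R and y :: "real^'n"
    assume R: "2 * norm x + 1 \<le> R" "R - norm x \<le> norm y"
    have R0: "R > 0" "R / 2 \<le> norm y" using R norm_ge_zero[of x] by linarith+
    have p: "p + 1 > 0" using s by (simp add: p_def)
    have "\<bar>?W y - 0\<bar> \<le> C * bracket_powr (p + 1) y" using C(2) by simp
    also have "\<dots> \<le> C * (R / 2) powr (- (p + 1))"
    proof (rule mult_left_mono[OF _ C(1)])
      have "(R / 2)\<^sup>2 \<le> (norm y)\<^sup>2" using R0 by (intro power_mono) auto
      then have "bracket_powr (p + 1) y \<le> ((R / 2)\<^sup>2) powr (- (p + 1) / 2)"
        unfolding bracket_powr_def
      proof (intro powr_mono2')
        show "- (p + 1) / 2 \<le> 0" "0 < (R / 2)\<^sup>2" using p R0(1) by simp_all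
        show "(R / 2)\<^sup>2 \<le> 1 + (norm y)\<^sup>2" using \<open>(R / 2)\<^sup>2 \<le> (norm y)\<^sup>2\<close> by linarith
      qed
      also have "\<dots> = (R / 2) powr (- (p + 1))"
      proof -
        have "((R / 2)\<^sup>2) powr (- (p + 1) / 2) = ((R / 2) powr 2) powr (- (p + 1) / 2)"
          using R0 by simp
        also have "\<dots> = (R / 2) powr (- (p + 1))"
          unfolding powr_powr by (rule arg_cong[where f="\<lambda>e. (R / 2) powr e"]) simp
        finally show ?thesis .
      qed
      finally show "bracket_powr (p + 1) y \<le> (R / 2) powr (- (p + 1))" .
    qed
    also have "\<dots> = C * 2 powr (p + 1) * R powr (- (p + 1))"
      by (simp only: half_powr[OF R0(1)] mult.assoc)
    finally show "\<bar>?W y - 0\<bar> \<le> C * 2 powr (p + 1) * R powr (- (p + 1))" .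
  qed
  from tendsto_add[OF this lim0]
  have "((\<lambda>R. LINT y:cball x R|lborel. ?W y) \<longlongrightarrow> (\<integral>n. ?W n + ?W (- n) \<partial>lborel) / 2) at_top"
    by simp
  with lim0 show ?thesis by (rule that)
qed

section \<open>Principal values on the sphere and on Euclidean space\<close>

lemma has_bochner_integral_sphere_truncated:
  fixes x :: "real^'n" and s :: real
  assumes u: "continuous_on unit_sphere u" and \<epsilon>: "\<epsilon> > 0"
  defines "z \<equiv> stereo_inv x"
  shows "has_bochner_integral sphere_volume
      (\<lambda>y. indicator {y \<in> space sphere_volume. \<epsilon> \<le> dist z y} y *\<^sub>R frac_integrand CARD('n) s u z y)
      (4 powr (- s) * (LINT n:cball 0 (sqrt (4 / \<epsilon>\<^sup>2 - 1))|lborel. chart_integrand s u x n))"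
proof -
  let ?N = "real CARD('n)" and ?\<zeta> = "antipodal_param x"
  define \<rho> where "\<rho> = sqrt (4 / \<epsilon>\<^sup>2 - 1)"
  define g where "g y = (if \<epsilon> \<le> dist z y then (u z - u y) / norm (z - y) powr (?N + 2 * s) else 0)" for y
  have um: "u \<in> borel_measurable (restrict_space borel unit_sphere)"
    by (rule borel_measurable_continuous_on_restrict[OF u])
  have dm: "(\<lambda>y. dist z y) \<in> borel_measurable (restrict_space borel unit_sphere)"
    "(\<lambda>y. norm (z - y)) \<in> borel_measurable (restrict_space borel unit_sphere)"
    by (rule measurable_restrict_space1, measurable)+
  have gm: "g \<in> borel_measurable (restrict_space borel unit_sphere)"
    unfolding g_def using um dm by measurable
  have conv: "indicator {y \<in> space sphere_volume. \<epsilon> \<le> dist z y} y *\<^sub>R frac_integrand CARD('n) s u z y = g y"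
    if "y \<in> space sphere_volume" for y
    using that by (simp add: g_def frac_integrand_def indicator_def)
  have key: "conf_factor n ^ CARD('n) * g (?\<zeta> n) =
      4 powr (- s) * (indicator (cball 0 \<rho>) n *\<^sub>R chart_integrand s u x n)" for n :: "real^'n"
  proof -
    define q where "q = 1 + (norm n)\<^sup>2"
    have q: "q > 0" by (simp add: q_def add_pos_nonneg)
    have d: "norm (z - ?\<zeta> n) = 2 / sqrt q"
      unfolding z_def q_def by (subst norm_minus_commute) (rule norm_antipodal_param_diff)
    \<comment> \<open>For \<open>\<epsilon> > 2\<close> the radicand in \<open>\<rho>\<close> is negative, hence so is \<open>\<rho>\<close>, and both sides fail.\<close>
    have "\<epsilon> \<le> 2 / sqrt q \<longleftrightarrow> \<epsilon>\<^sup>2 \<le> (2 / sqrt q)\<^sup>2"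
      using \<epsilon> q by (intro power_mono_iff[symmetric]) auto
    also have "\<dots> \<longleftrightarrow> (norm n)\<^sup>2 \<le> 4 / \<epsilon>\<^sup>2 - 1"
      using \<epsilon> q by (simp add: power_divide q_def divide_simps algebra_simps)
    also have "\<dots> \<longleftrightarrow> sqrt ((norm n)\<^sup>2) \<le> \<rho>"
      unfolding \<rho>_def by (rule real_sqrt_le_iff[symmetric])
    finally have ball: "\<epsilon> \<le> dist z (?\<zeta> n) \<longleftrightarrow> n \<in> cball 0 \<rho>"
      by (simp add: dist_norm d)
    have "(2 / q) ^ CARD('n) / (2 / sqrt q) powr (?N + 2 * s) = 4 powr (- s) * q powr (- (?N - 2 * s) / 2)"
    proof -
      have "(2 / q) ^ CARD('n) = 2 powr ?N * q powr (- ?N)"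
        using q by (simp add: powr_realpow[symmetric] powr_divide powr_minus_divide)
      moreover have "(2 / sqrt q) powr (?N + 2 * s) = 2 powr (?N + 2 * s) * q powr (- (?N + 2 * s) / 2)"
      proof -
        have "(2 / sqrt q) powr K = 2 powr K * q powr (- K / 2)" for K
          using q by (simp add: powr_divide powr_half_sqrt[symmetric] powr_powr powr_minus_divide)
        then show ?thesis .
      qed
      moreover have "2 powr ?N / 2 powr (?N + 2 * s) = 4 powr (- s)"
      proof -
        have "2 powr ?N / 2 powr (?N + 2 * s) = (2::real) powr (2 * (- s))"
          by (simp add: powr_diff[symmetric])
        also have "\<dots> = (2 powr 2) powr (- s)" by (rule powr_powr[symmetric])
        finally show ?thesis by simp
      qed
      moreover have "q powr (- ?N) / q powr (- (?N + 2 * s) / 2) = q powr (- (?N - 2 * s) / 2)"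
        by (simp add: powr_diff[symmetric]) (simp add: field_simps)
      ultimately show ?thesis by (simp only: times_divide_times_eq[symmetric])
    qed
    then have *: "conf_factor n ^ CARD('n) / norm (z - ?\<zeta> n) powr (?N + 2 * s) = 4 powr (- s) * bracket_powr (?N - 2 * s) n"
      unfolding d by (simp only: conf_factor_def bracket_powr_def q_def)
    show ?thesis
    proof (cases "n \<in> cball 0 \<rho>")
      case True
      then have "conf_factor n ^ CARD('n) * g (?\<zeta> n) =
          (u z - u (?\<zeta> n)) * (conf_factor n ^ CARD('n) / norm (z - ?\<zeta> n) powr (?N + 2 * s))"
        using ball by (simp add: g_def)
      also have "\<dots> = 4 powr (- s) * chart_integrand s u x n"
        unfolding * by (simp add: chart_integrand_def z_def)
      finally show ?thesis using True by simp
    next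
      case False
      then show ?thesis using ball by (simp add: g_def)
    qed
  qed
  have "set_integrable lborel (cball 0 \<rho>) (chart_integrand s u x)"
    by (rule set_integrable_cball_continuous[OF continuous_chart_integrand[OF u]])
  then have "has_bochner_integral lborel (\<lambda>n. 4 powr (- s) * (indicator (cball 0 \<rho>) n *\<^sub>R chart_integrand s u x n))
      (4 powr (- s) * (LINT n:cball 0 \<rho>|lborel. chart_integrand s u x n))"
    unfolding set_integrable_def set_lebesgue_integral_def
    by (intro has_bochner_integral_mult_right has_bochner_integral_integrable)
  then have "has_bochner_integral sphere_volume g (4 powr (- s) * (LINT n:cball 0 \<rho>|lborel. chart_integrand s u x n))"
    unfolding has_bochner_integral_sphere_volume[OF gm, of _ x] key .
  then show ?thesis
    unfolding \<rho>_def by (subst has_bochner_integral_cong[OF refl conv refl])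
qed

lemma psi_eq: "psi s (x :: real^'n) = conf_factor x powr ((real CARD('n) - 2 * s) / 2)"
  by (simp add: psi_def conf_factor_def)

text \<open>
  The integrand on the flat space in the coordinate \<open>m\<close> of the inversion about \<open>x\<close>, without its
  constant factor. The shift by \<open>x\<close> in the second term comes from \<open>n = x + m\<close>.
\<close>

definition flat_chart_integrand :: "real \<Rightarrow> ((real^'n) \<times> real \<Rightarrow> real) \<Rightarrow> real^'n \<Rightarrow> real^'n \<Rightarrow> real" where
  "flat_chart_integrand s u x m = u (stereo_inv x) * norm m powr (- (real CARD('n) - 2 * s)) -
     u (antipodal_param x (x + m)) * bracket_powr (real CARD('n) - 2 * s) (x + m)"

text \<open>
  The kernel \<open>|x - y| powr (- N - 2 s)\<close> and the Jacobian \<open>(a / |m|^2) ^ N\<close> combine to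
  \<open>a powr (- 2 s) * |m| powr (- p)\<close>, and \<open>psi s\<close> at the inverted point supplies the factor
  \<open>|m| powr p * bracket_powr p (x + m)\<close>.
\<close>

lemma has_bochner_integral_flat_truncated:
  fixes x :: "real^'n" and s :: real
  assumes u: "continuous_on unit_sphere u" and \<epsilon>: "\<epsilon> > 0"
    and int: "\<And>R. set_integrable lborel (cball 0 R) (flat_chart_integrand s u x)"
  defines "a \<equiv> 1 + (norm x)\<^sup>2" and "p \<equiv> real CARD('n) - 2 * s"
  shows "has_bochner_integral lborel
      (\<lambda>y. indicator {y \<in> space lborel. \<epsilon> \<le> dist x y} y *\<^sub>R
        frac_integrand CARD('n) s (\<lambda>y. psi s y * u (stereo_inv y)) x y)
      (a powr (- 2 * s) * (2 / a) powr (p / 2) * (LINT m:cball 0 (a / \<epsilon>)|lborel. flat_chart_integrand s u x m))"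
proof -
  let ?N = "real CARD('n)" and ?\<zeta> = "antipodal_param x" and ?w = "\<lambda>y. psi s y * u (stereo_inv y)"
  define c where "c = a powr (- 2 * s) * (2 / a) powr (p / 2)"
  define g where "g y = indicator {y. \<epsilon> \<le> dist x y} y *\<^sub>R frac_integrand CARD('n) s ?w x y" for y
  have a: "a > 0" by (simp add: a_def add_pos_nonneg)
  have "continuous_on UNIV (\<lambda>y. u (stereo_inv y))"
    by (rule continuous_on_compose2[OF u continuous_stereo_inv]) (auto simp: norm_stereo_inv)
  then have [measurable]: "(\<lambda>y. u (stereo_inv y)) \<in> borel_measurable borel"
    by (rule borel_measurable_continuous_onI)
  have [measurable]: "(psi s :: real^'n \<Rightarrow> real) \<in> borel_measurable borel"
    unfolding psi_def[abs_def] by measurable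
  have gm [measurable]: "g \<in> borel_measurable borel"
    unfolding g_def frac_integrand_def by measurable
  have key: "(\<bar>a\<bar> / (norm m)\<^sup>2) ^ CARD('n) * g (x + inversion a m) =
      c * (indicator (cball 0 (a / \<epsilon>)) m *\<^sub>R flat_chart_integrand s u x m)" if m: "m \<noteq> 0" for m
  proof -
    define r where "r = norm m"
    define q where "q = 1 + (norm (x + m))\<^sup>2"
    have r: "r > 0" and q: "q > 0" using m by (simp_all add: r_def q_def add_pos_nonneg)
    have d: "norm (inversion a m) = a / r"
      using a m by (simp add: inversion_def r_def power2_eq_square)
    have ball: "\<epsilon> \<le> dist x (x + inversion a m) \<longleftrightarrow> m \<in> cball 0 (a / \<epsilon>)"
      using \<epsilon> r by (simp add: dist_norm d r_def[symmetric] divide_simps mult.commute)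
    have "conf_factor (x + inversion a m) = (2 / a) * (r\<^sup>2 / q)"
      unfolding conf_factor_def a_def one_plus_norm_sq_inversion[OF m] by (simp add: r_def q_def)
    then have "psi s (x + inversion a m) = (2 / a) powr (p / 2) * (r powr p * q powr (- p / 2))"
    proof -
      have "((2 / a) * (r\<^sup>2 / q)) powr (p / 2) = (2 / a) powr (p / 2) * ((r powr 2) powr (p / 2) * q powr (- p / 2))"
        using a r q by (simp add: powr_mult powr_divide powr_minus_divide)
      also have "(r powr 2) powr (p / 2) = r powr p" unfolding powr_powr by simp
      finally show ?thesis
        unfolding psi_eq \<open>conf_factor (x + inversion a m) = (2 / a) * (r\<^sup>2 / q)\<close> p_def[symmetric] .
    qed
    moreover have "psi s x = (2 / a) powr (p / 2)"
      by (simp add: psi_def a_def p_def)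
    moreover have "stereo_inv (x + inversion a m) = ?\<zeta> (x + m)"
      unfolding a_def by (rule stereo_inv_inversion[OF m])
    ultimately have w: "?w x - ?w (x + inversion a m) =
        (2 / a) powr (p / 2) * (u (stereo_inv x) - r powr p * q powr (- p / 2) * u (?\<zeta> (x + m)))"
      by (simp add: algebra_simps)
    have quot: "(\<bar>a\<bar> / r\<^sup>2) ^ CARD('n) / (a / r) powr (?N + 2 * s) = a powr (- 2 * s) * r powr (- p)"
    proof -
      have "(\<bar>a\<bar> / r\<^sup>2) ^ CARD('n) = (a / r powr 2) powr ?N"
        using a r by (simp add: powr_realpow)
      also have "\<dots> = a powr ?N / (r powr 2) powr ?N"
        by (rule powr_divide)
      also have "\<dots> = a powr ?N * (r powr 2) powr (- ?N)"
        by (simp only: powr_minus_divide times_divide_eq_right mult_1_right)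
      also have "\<dots> = a powr ?N * r powr (- 2 * ?N)" unfolding powr_powr by simp
      finally have 1: "(\<bar>a\<bar> / r\<^sup>2) ^ CARD('n) = a powr ?N * r powr (- 2 * ?N)" .
      have 2: "(a / r) powr (?N + 2 * s) = a powr (?N + 2 * s) * r powr (- (?N + 2 * s))"
        by (simp only: powr_divide powr_minus_divide times_divide_eq_right mult_1_right)
      have 3: "a powr ?N / a powr (?N + 2 * s) = a powr (- 2 * s)"
        by (simp add: powr_diff[symmetric])
      have "- 2 * ?N - - (?N + 2 * s) = - p" by (simp add: p_def)
      then have 4: "r powr (- 2 * ?N) / r powr (- (?N + 2 * s)) = r powr (- p)"
        by (simp only: powr_diff[symmetric])
      show ?thesis unfolding 1 2 times_divide_times_eq[symmetric] 3 4 ..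
    qed
    have jac: "(\<bar>a\<bar> / r\<^sup>2) ^ CARD('n) * (W / (a / r) powr (?N + 2 * s)) = a powr (- 2 * s) * r powr (- p) * W" for W
      by (subst quot[symmetric]) simp
    have "(\<bar>a\<bar> / r\<^sup>2) ^ CARD('n) * ((?w x - ?w (x + inversion a m)) / (a / r) powr (?N + 2 * s)) =
        a powr (- 2 * s) * r powr (- p) * (?w x - ?w (x + inversion a m))"
      by (rule jac)
    also have "\<dots> = c * (u (stereo_inv x) * r powr (- p) - (r powr (- p) * r powr p) * q powr (- p / 2) * u (?\<zeta> (x + m)))"
      unfolding w c_def by (simp only: right_diff_distrib mult_ac)
    also have "r powr (- p) * r powr p = 1" using r by (simp add: powr_add[symmetric])
    also have "u (stereo_inv x) * r powr (- p) - 1 * q powr (- p / 2) * u (?\<zeta> (x + m)) = flat_chart_integrand s u x m"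
      by (simp add: flat_chart_integrand_def bracket_powr_def r_def q_def p_def)
    finally show ?thesis
      using ball by (simp add: g_def frac_integrand_def d r_def[symmetric] indicator_def)
  qed
  have hm: "(\<lambda>m. c * (indicator (cball 0 (a / \<epsilon>)) m *\<^sub>R flat_chart_integrand s u x m)) \<in> borel_measurable lborel"
    using int[of "a / \<epsilon>"] unfolding set_integrable_def by (intro borel_measurable_times borel_measurable_const borel_measurable_integrable)
  have "has_bochner_integral lborel (\<lambda>m. c * (indicator (cball 0 (a / \<epsilon>)) m *\<^sub>R flat_chart_integrand s u x m))
      (c * (LINT m:cball 0 (a / \<epsilon>)|lborel. flat_chart_integrand s u x m))"
    using int[of "a / \<epsilon>"] unfolding set_integrable_def set_lebesgue_integral_def
    by (intro has_bochner_integral_mult_right has_bochner_integral_integrable)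
  also have "?this \<longleftrightarrow> has_bochner_integral lborel (\<lambda>m. (\<bar>a\<bar> / (norm m)\<^sup>2) ^ CARD('n) * g (x + inversion a m))
      (c * (LINT m:cball 0 (a / \<epsilon>)|lborel. flat_chart_integrand s u x m))"
  proof (rule has_bochner_integral_cong_AE[OF hm])
    show "AE m in lborel. c * (indicator (cball 0 (a / \<epsilon>)) m *\<^sub>R flat_chart_integrand s u x m) =
        (\<bar>a\<bar> / (norm m)\<^sup>2) ^ CARD('n) * g (x + inversion a m)"
      using AE_lborel_singleton[of "0 :: real^'n"] by eventually_elim (rule key[symmetric])
  qed measurable
  also have "\<dots> \<longleftrightarrow> has_bochner_integral lborel g (c * (LINT m:cball 0 (a / \<epsilon>)|lborel. flat_chart_integrand s u x m))"
    using a by (intro has_bochner_integral_lborel_inversion_at[symmetric] gm) simp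
  finally show ?thesis by (simp add: g_def[abs_def] c_def)
qed

lemma set_integral_cball_translate:
  fixes f :: "'a::euclidean_space \<Rightarrow> real"
  assumes "set_integrable lborel (cball x R) f" and [measurable]: "f \<in> borel_measurable borel"
  shows "set_integrable lborel (cball 0 R) (\<lambda>y. f (x + y))"
    and "(LINT y:cball 0 R|lborel. f (x + y)) = (LINT y:cball x R|lborel. f y)"
proof -
  have "has_bochner_integral lborel (\<lambda>y. indicator (cball x R) y *\<^sub>R f y) (LINT y:cball x R|lborel. f y)"
    using assms(1) by (simp add: set_integrable_def set_lebesgue_integral_def has_bochner_integral_integrable)
  then have "has_bochner_integral lborel (\<lambda>y. indicator (cball x R) (x + y) *\<^sub>R f (x + y)) (LINT y:cball x R|lborel. f y)"
    by (rule has_bochner_integral_translate[THEN iffD1, rotated])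
       (intro borel_measurable_scaleR borel_measurable_indicator, auto)
  also have "(\<lambda>y. indicator (cball x R) (x + y) *\<^sub>R f (x + y)) = (\<lambda>y. indicator (cball 0 R) y *\<^sub>R f (x + y))"
    by (auto simp: indicator_def dist_norm)
  finally show "set_integrable lborel (cball 0 R) (\<lambda>y. f (x + y))"
    and "(LINT y:cball 0 R|lborel. f (x + y)) = (LINT y:cball x R|lborel. f y)"
    by (auto simp: set_integrable_def set_lebesgue_integral_def has_bochner_integral_iff)
qed

text \<open>
  The integrand splits as \<open>u z * (|m| powr (- p) - b m) + u z * (b m - b (x + m)) + W (x + m)\<close>. The first
  term is integrable, and the second contributes nothing in the limit.
\<close>

lemma flat_chart_integrand_ball_limit:
  fixes x :: "real^'n"
  assumes s: "0 < s" "s < 1" "2 * s < real CARD('n)" and u: "continuous_on unit_sphere u"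
    and I: "((\<lambda>R. LINT n:cball x R|lborel. chart_integrand s u x n) \<longlongrightarrow> I) at_top"
  shows "set_integrable lborel (cball 0 R) (flat_chart_integrand s u x)"
    and "((\<lambda>R. LINT m:cball 0 R|lborel. flat_chart_integrand s u x m) \<longlongrightarrow>
      u (stereo_inv x) * (pi powr (CARD('n) / 2) * Gamma (1 - s) / (s * Gamma (CARD('n) / 2 - s))) + I) at_top"
proof -
  define p where "p = real CARD('n) - 2 * s"
  let ?b = "bracket_powr p :: real^'n \<Rightarrow> real" and ?W = "chart_integrand s u x" and ?z = "stereo_inv x"
  define h where "h m = norm m powr (- p) - ?b m" for m :: "real^'n"
  define C where "C = pi powr (CARD('n) / 2) * Gamma (1 - s) / (s * Gamma (CARD('n) / 2 - s))"
  have h: "has_bochner_integral lborel h C"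
    using has_bochner_integral_powr_minus_bracket[where 'a = "real^'n" and s = s] s
    by (simp add: h_def[abs_def] C_def p_def bracket_powr_def)
  have hi: "set_integrable lborel (cball 0 R) h" for R
    using h unfolding set_integrable_def has_bochner_integral_iff
    by (intro integrable_mult_indicator) auto
  have bi: "set_integrable lborel (cball c R) ?b" for c R
    by (rule set_integrable_cball_continuous[OF continuous_bracket_powr])
  have Wi: "set_integrable lborel (cball c R) ?W" for c R
    by (rule set_integrable_cball_continuous[OF continuous_chart_integrand[OF u]])
  note bt = set_integral_cball_translate[OF bi borel_measurable_continuous_onI[OF continuous_bracket_powr]]
  note Wt = set_integral_cball_translate[OF Wi borel_measurable_continuous_onI[OF continuous_chart_integrand[OF u]]]
  have split: "flat_chart_integrand s u x = (\<lambda>m. u ?z * (h m + (?b m - ?b (x + m))) + ?W (x + m))"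
    by (auto simp: flat_chart_integrand_def chart_integrand_def h_def p_def algebra_simps)
  have i1: "set_integrable lborel (cball 0 R) (\<lambda>m. ?b m - ?b (x + m))" for R
    by (intro set_integral_diff(1) bi bt(1))
  have i2: "set_integrable lborel (cball 0 R) (\<lambda>m. u ?z * (h m + (?b m - ?b (x + m))))" for R
    by (intro set_integrable_mult_right set_integral_add(1) hi i1)
  show int: "set_integrable lborel (cball 0 R) (flat_chart_integrand s u x)" for R
    unfolding split by (intro set_integral_add(1) i2 Wt(1))
  have eq: "(LINT m:cball 0 R|lborel. flat_chart_integrand s u x m) =
      u ?z * ((LINT m:cball 0 R|lborel. h m) - ((LINT m:cball x R|lborel. ?b m) - (LINT m:cball 0 R|lborel. ?b m)))
      + (LINT m:cball x R|lborel. ?W m)" for R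
    unfolding split set_integral_add(2)[OF i2 Wt(1)] Wt(2) set_integral_mult_right
      set_integral_add(2)[OF hi i1] set_integral_diff(2)[OF bi bt(1)] bt(2)
    by simp
  have "((\<lambda>R. LINT m:cball 0 R|lborel. h m) \<longlongrightarrow> C) at_top"
    using ball_integral_tendsto[of h] h by (simp add: has_bochner_integral_iff)
  moreover have "((\<lambda>R. (LINT m:cball x R|lborel. ?b m) - (LINT m:cball 0 R|lborel. ?b m)) \<longlongrightarrow> 0) at_top"
    by (rule bracket_powr_shifted_ball) (use s in \<open>auto simp: p_def\<close>)
  ultimately have "((\<lambda>R. u ?z * ((LINT m:cball 0 R|lborel. h m) - ((LINT m:cball x R|lborel. ?b m) - (LINT m:cball 0 R|lborel. ?b m)))
      + (LINT m:cball x R|lborel. ?W m)) \<longlongrightarrow> u ?z * (C - 0) + I) at_top"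
    by (intro tendsto_intros I)
  then show "((\<lambda>R. LINT m:cball 0 R|lborel. flat_chart_integrand s u x m) \<longlongrightarrow>
      u (stereo_inv x) * (pi powr (CARD('n) / 2) * Gamma (1 - s) / (s * Gamma (CARD('n) / 2 - s))) + I) at_top"
    unfolding eq C_def by simp
qed

lemma has_pv_integralI:
  fixes f :: "'a::metric_space \<Rightarrow> real"
  assumes trunc: "\<And>\<epsilon>. \<epsilon> > 0 \<Longrightarrow>
      has_bochner_integral M (\<lambda>y. indicator {y \<in> space M. \<epsilon> \<le> dist z y} y *\<^sub>R f y) (F \<epsilon>)"
    and "(F \<longlongrightarrow> I) (at_right 0)"
  shows "has_pv_integral M f z I"
proof -
  have "\<forall>\<^sub>F \<epsilon> in at_right 0. F \<epsilon> = (LINT y:{y \<in> space M. \<epsilon> \<le> dist z y}|M. f y)"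
    using eventually_at_right_less[of "0::real"]
    by eventually_elim
       (use trunc in \<open>auto simp: has_bochner_integral_iff set_lebesgue_integral_def\<close>)
  with assms(2) have "((\<lambda>\<epsilon>. LINT y:{y \<in> space M. \<epsilon> \<le> dist z y}|M. f y) \<longlongrightarrow> I) (at_right 0)"
    by (rule Lim_transform_eventually)
  with trunc show ?thesis
    by (auto simp: has_pv_integral_def set_integrable_def has_bochner_integral_iff)
qed

lemma pv_integral_eq: "has_pv_integral M f z I \<Longrightarrow> pv_integral M f z = I"
  unfolding pv_integral_def has_pv_integral_def
  by (rule the_equality) (auto intro: tendsto_unique[OF trivial_limit_at_right_real])

lemma has_pv_integral_sphere:
  fixes x :: "real^'n" and s :: real
  assumes u: "continuous_on unit_sphere u"
    and I: "((\<lambda>R. LINT n:cball 0 R|lborel. chart_integrand s u x n) \<longlongrightarrow> I) at_top"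
  shows "has_pv_integral sphere_volume (frac_integrand CARD('n) s u (stereo_inv x)) (stereo_inv x) (4 powr (- s) * I)"
proof (rule has_pv_integralI[OF has_bochner_integral_sphere_truncated[OF u]])
  have "filterlim (\<lambda>\<epsilon>::real. sqrt (4 / \<epsilon>\<^sup>2 - 1)) at_top (at_right 0)"
    by real_asymp
  from filterlim_compose[OF I this]
  show "((\<lambda>\<epsilon>. 4 powr (- s) * (LINT n:cball 0 (sqrt (4 / \<epsilon>\<^sup>2 - 1))|lborel. chart_integrand s u x n))
      \<longlongrightarrow> 4 powr (- s) * I) (at_right 0)"
    by (rule tendsto_mult_left)
qed

lemma has_pv_integral_flat:
  fixes x :: "real^'n" and s :: real
  assumes s: "0 < s" "s < 1" "2 * s < real CARD('n)" and u: "continuous_on unit_sphere u"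
    and I: "((\<lambda>R. LINT n:cball x R|lborel. chart_integrand s u x n) \<longlongrightarrow> I) at_top"
  shows "has_pv_integral lborel (frac_integrand CARD('n) s (\<lambda>y. psi s y * u (stereo_inv y)) x) x
    ((1 + (norm x)\<^sup>2) powr (- 2 * s) * conf_factor x powr ((real CARD('n) - 2 * s) / 2) *
      (u (stereo_inv x) * (pi powr (CARD('n) / 2) * Gamma (1 - s) / (s * Gamma (CARD('n) / 2 - s))) + I))"
  unfolding conf_factor_def
proof (rule has_pv_integralI[OF has_bochner_integral_flat_truncated[OF u]])
  show "set_integrable lborel (cball 0 R) (flat_chart_integrand s u x)" for R
    by (rule flat_chart_integrand_ball_limit(1)[OF s u I])
  have "1 + (norm x)\<^sup>2 > 0" by (simp add: add_pos_nonneg)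
  then have "filterlim (\<lambda>\<epsilon>. (1 + (norm x)\<^sup>2) / \<epsilon>) at_top (at_right 0)"
    by real_asymp
  from filterlim_compose[OF flat_chart_integrand_ball_limit(2)[OF s u I] this]
  show "((\<lambda>\<epsilon>. (1 + (norm x)\<^sup>2) powr (- 2 * s) * (2 / (1 + (norm x)\<^sup>2)) powr ((real CARD('n) - 2 * s) / 2) *
      (LINT m:cball 0 ((1 + (norm x)\<^sup>2) / \<epsilon>)|lborel. flat_chart_integrand s u x m)) \<longlongrightarrow>
      (1 + (norm x)\<^sup>2) powr (- 2 * s) * (2 / (1 + (norm x)\<^sup>2)) powr ((real CARD('n) - 2 * s) / 2) *
      (u (stereo_inv x) * (pi powr (CARD('n) / 2) * Gamma (1 - s) / (s * Gamma (CARD('n) / 2 - s))) + I)) (at_right 0)"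
    by (rule tendsto_mult_left)
qed

lemma c_const_mult_bubble_constant:
  fixes s :: real
  assumes "0 < s" "s < 1"
  shows "4 powr (- s) * c_const N s * (pi powr (N / 2) * Gamma (1 - s) / (s * Gamma (N / 2 - s))) = A_const N s"
proof -
  have "Gamma (1 + (1 - s)) = (1 - s) * Gamma (1 - s)"
    using assms by (subst add.commute, subst Gamma_plus1) auto
  then have G: "Gamma (2 - s) = (1 - s) * Gamma (1 - s)" by simp
  have "Gamma (1 - s) \<noteq> 0" using assms Gamma_real_pos[of "1 - s"] by (metis diff_gt_0_iff_gt less_irrefl)
  then have "Gamma (1 - s) * (s * (1 - s)) / (s * Gamma (2 - s)) = 1"
    unfolding G using assms by simp
  moreover have "4 powr (- s) * 4 powr s = (1::real)" "pi powr (- (real N / 2)) * pi powr (real N / 2) = 1"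
    by (simp_all add: powr_add[symmetric])
  moreover have "4 powr (- s) * c_const N s * (pi powr (N / 2) * Gamma (1 - s) / (s * Gamma (N / 2 - s))) =
     (4 powr (- s) * 4 powr s) * (pi powr (- (real N / 2)) * pi powr (real N / 2)) *
     (Gamma (1 - s) * (s * (1 - s)) / (s * Gamma (2 - s))) * A_const N s"
    by (simp add: c_const_def A_const_def)
  ultimately show ?thesis by simp
qed

theorem lemma1p1:
  fixes s :: real
    and u :: "(real^'n) \<times> real \<Rightarrow> real"
    and v :: "real^'n \<Rightarrow> real"
    and z :: "(real^'n) \<times> real"
    and x :: "real^'n"
  assumes "CARD('n) \<ge> 3"
    and "0 < s" and "s < 1"
    and "smooth_fun_on unit_sphere u"
    and "v = u \<circ> stereo_inv"
    and "z \<in> unit_sphere - {- north}"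
    and "x = stereo z"
  shows "(\<exists>I. has_pv_integral sphere_volume (frac_integrand CARD('n) s u z) z I) \<and>
    (\<exists>J. has_pv_integral lborel (frac_integrand CARD('n) s (\<lambda>y. psi s y * v y) x) x J) \<and>
    conf_frac_laplacian s u z =
      psi s x powr (- ((real CARD('n) + 2 * s) / (real CARD('n) - 2 * s))) *
      frac_laplacian s (\<lambda>y. psi s y * v y) x"
proof -
  define p where "p = real CARD('n) - 2 * s"
  define a where "a = 1 + (norm x)\<^sup>2"
  define B where "B = pi powr (CARD('n) / 2) * Gamma (1 - s) / (s * Gamma (CARD('n) / 2 - s))"
  have s: "0 < s" "s < 1" "2 * s < real CARD('n)" using assms(1-3) by auto
  have p: "p > 0" using s by (simp add: p_def)
  have a: "a > 0" by (simp add: a_def add_pos_nonneg)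
  have z: "stereo_inv x = z" using stereo_inv_stereo[OF assms(6)] assms(7) by simp
  have u: "continuous_on unit_sphere u" by (rule smooth_fun_on_imp_continuous_on[OF assms(4)])
  obtain I where I: "((\<lambda>R. LINT n:cball 0 R|lborel. chart_integrand s u x n) \<longlongrightarrow> I) at_top"
    "((\<lambda>R. LINT n:cball x R|lborel. chart_integrand s u x n) \<longlongrightarrow> I) at_top"
    by (rule chart_integrand_ball_limits[OF s assms(4)])
  have S: "has_pv_integral sphere_volume (frac_integrand CARD('n) s u z) z (4 powr (- s) * I)"
    using has_pv_integral_sphere[OF u I(1)] unfolding z .
  have E: "has_pv_integral lborel (frac_integrand CARD('n) s (\<lambda>y. psi s y * v y) x) x
      (a powr (- 2 * s) * (2 / a) powr (p / 2) * (u z * B + I))"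
    using has_pv_integral_flat[OF s u I(2)] unfolding z assms(5) a_def p_def B_def conf_factor_def by simp
  have "psi s x powr (- ((real CARD('n) + 2 * s) / p)) = (2 / a) powr (- (p + 4 * s) / 2)"
  proof -
    have "p / 2 * (- ((real CARD('n) + 2 * s) / p)) = - (p + 4 * s) / 2"
    proof -
      have "real CARD('n) + 2 * s = p + 4 * s" by (simp add: p_def)
      then show ?thesis using p by (simp only:) (simp add: field_simps)
    qed
    then show ?thesis by (simp only: psi_def powr_powr a_def p_def)
  qed
  moreover have "(2 / a) powr (- (p + 4 * s) / 2) * (a powr (- 2 * s) * (2 / a) powr (p / 2)) = 4 powr (- s)"
  proof -
    have "(2 / a) powr (- (p + 4 * s) / 2) * (2 / a) powr (p / 2) = (2 / a) powr (- 2 * s)"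
      unfolding powr_add[symmetric] by (rule arg_cong2[where f = "(powr)"]) (auto simp: field_simps)
    moreover have "(2 / a) powr (- 2 * s) * a powr (- 2 * s) = (2 powr 2) powr (- s)"
      using a unfolding powr_powr by (simp add: powr_mult[symmetric])
    ultimately show ?thesis by (simp add: mult_ac)
  qed
  ultimately have P: "psi s x powr (- ((real CARD('n) + 2 * s) / p)) * (a powr (- 2 * s) * (2 / a) powr (p / 2)) = 4 powr (- s)"
    by (simp only:)
  have "psi s x powr (- ((real CARD('n) + 2 * s) / p)) *
      (c_const CARD('n) s * (a powr (- 2 * s) * (2 / a) powr (p / 2) * (u z * B + I))) =
      psi s x powr (- ((real CARD('n) + 2 * s) / p)) * (a powr (- 2 * s) * (2 / a) powr (p / 2)) *
      c_const CARD('n) s * (u z * B + I)"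
    by (simp only: mult_ac)
  also have "\<dots> = 4 powr (- s) * c_const CARD('n) s * (u z * B + I)"
    by (simp only: P)
  also have "\<dots> = c_const CARD('n) s * (4 powr (- s) * I) + 4 powr (- s) * c_const CARD('n) s * B * u z"
    by (simp only: distrib_left distrib_right mult_ac add.commute)
  also have "4 powr (- s) * c_const CARD('n) s * B = A_const CARD('n) s"
    unfolding B_def by (rule c_const_mult_bubble_constant[OF s(1,2)])
  finally have identity: "conf_frac_laplacian s u z =
      psi s x powr (- ((real CARD('n) + 2 * s) / (real CARD('n) - 2 * s))) *
      frac_laplacian s (\<lambda>y. psi s y * v y) x"
    unfolding conf_frac_laplacian_def frac_laplacian_def pv_integral_eq[OF S] pv_integral_eq[OF E] p_def[symmetric]
    by (rule sym)
  show ?thesis by (intro conjI identity) (rule exI, rule S, rule exI, rule E)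
qed

end
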